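(* Let $\{\rho_\theta;\theta\in\Theta\}$ be a model as in the context, $g:\Theta\to\mathbb R$, $\theta$ an interior point of $\Theta$, and $(c_n)$ an increasing sequence of positive reals with $c_n\to\infty$. Let $(M_n)$ be a sequence of estimators, $M_n$ a POVM on $\mathcal H^{\otimes n}$. (i) If $M_n$ is $c_n$-unbiased at $\theta$ from the right, $g'_1(\theta)$ exists and is finite, and $0<J^{R,1}_\theta<\infty$, then $\liminf_{n\to\infty}c_n^2V_\theta(M_n)\ge (g'_1(\theta))^2/J^{R,1}_\theta$. (ii) If $M_n$ is $c_n$-unbiased at $\theta$ from the left, $g'_0(\theta)$ exists and is finite, and $0<J^{R,0}_\theta<\infty$, then $\liminf_{n\to\infty}c_n^2V_\theta(M_n)\ge (g'_0(\theta))^2/J^{R,0}_\theta$.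
   Context: $\mathcal H$ is finite-dimensional; $\Theta\subset\mathbb R$; $\rho_\theta>0$ density operators. For $t\in[0,1]$, $\Delta^t_\delta f(\theta)=(f(\theta+t\delta)-f(\theta-(1-t)\delta))/\delta$. $L^{R,n,t}_{\theta,\delta}$ is the solution of $\Delta^t_\delta\rho_\theta^{\otimes n}=\rho_\theta^{\otimes n}L^{R,n,t}_{\theta,\delta}$. Define $J^{R,t}_\theta=\limsup_{h\to0+}\limsup_{n\to\infty}c_n^{-2}\mathrm{Tr}\big(\rho_\theta^{\otimes n}L^{R,n,t}_{\theta,h/c_n}(L^{R,n,t}_{\theta,h/c_n})^\dagger\big)$ and $g'_t(\theta)=\lim_{\delta\to0+}\Delta^t_\delta g(\theta)$. Bias $b(M_n,\theta')=\int(\gamma-g(\theta'))\mathrm{Tr}(\rho_{\theta'}^{\otimes n}M_n(d\gamma))$, MSE $V_{\theta'}(M_n)=\int(\gamma-g(\theta'))^2\mathrm{Tr}(\rho_{\theta'}^{\otimes n}M_n(d\gamma))$. $(M_n)$ is $c_n$-unbiased at $\theta$ from the right (resp. left) if $c_n b(M_n,\theta+h/c_n)\to0$ (resp. $c_nb(M_n,\theta-h/c_n)\to0$) as $n\to\infty$ for every sufficiently small $h\ge0$. *)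

theory Defs
  imports "HOL-Probability.Probability" "Jordan_Normal_Form.Matrix"
begin

text \<open>The Hilbert space is C^d, operators are d x d complex matrices.\<close>

definition mtrace :: "complex mat \<Rightarrow> complex" where
  "mtrace A = (\<Sum>i<dim_row A. A $$ (i,i))"

definition adj :: "complex mat \<Rightarrow> complex mat" where
  "adj A = mat (dim_col A) (dim_row A) (\<lambda>(i,j). cnj (A $$ (j,i)))"

definition qform :: "complex mat \<Rightarrow> complex vec \<Rightarrow> complex" where
  "qform A v = (\<Sum>i<dim_vec v. \<Sum>j<dim_vec v. cnj (v $ i) * A $$ (i,j) * v $ j)"

definition hermitian :: "nat \<Rightarrow> complex mat \<Rightarrow> bool" where
  "hermitian N A \<longleftrightarrow> A \<in> carrier_mat N N \<and> adj A = A"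

definition pos_semidef :: "nat \<Rightarrow> complex mat \<Rightarrow> bool" where
  "pos_semidef N A \<longleftrightarrow> hermitian N A \<and> (\<forall>v\<in>carrier_vec N. 0 \<le> Re (qform A v))"

definition pos_def :: "nat \<Rightarrow> complex mat \<Rightarrow> bool" where
  "pos_def N A \<longleftrightarrow> hermitian N A \<and> (\<forall>v\<in>carrier_vec N. v \<noteq> 0\<^sub>v N \<longrightarrow> 0 < Re (qform A v))"

definition density_pos :: "nat \<Rightarrow> complex mat \<Rightarrow> bool" where
  "density_pos N A \<longleftrightarrow> pos_def N A \<and> mtrace A = 1"

text \<open>Kronecker (tensor) product and tensor powers; C^d tensor n is identified with C^(d^n).\<close>
definition kron :: "complex mat \<Rightarrow> complex mat \<Rightarrow> complex mat" where
  "kron A B = mat (dim_row A * dim_row B) (dim_col A * dim_col B)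
     (\<lambda>(i,j). A $$ (i div dim_row B, j div dim_col B) * B $$ (i mod dim_row B, j mod dim_col B))"

fun tpow :: "complex mat \<Rightarrow> nat \<Rightarrow> complex mat" where
  "tpow A 0 = 1\<^sub>m 1"
| "tpow A (Suc n) = kron (tpow A n) A"

definition povm :: "nat \<Rightarrow> (real set \<Rightarrow> complex mat) \<Rightarrow> bool" where
  "povm N M \<longleftrightarrow>
     (\<forall>A\<in>sets borel. pos_semidef N (M A)) \<and>
     M UNIV = 1\<^sub>m N \<and>
     (\<forall>F::nat \<Rightarrow> real set. range F \<subseteq> sets borel \<longrightarrow> disjoint_family F \<longrightarrow>
        (\<forall>i<N. \<forall>j<N. (\<lambda>k. (M (F k)) $$ (i,j)) sums ((M (\<Union>k. F k)) $$ (i,j))))"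

definition outcome_dist :: "complex mat \<Rightarrow> (real set \<Rightarrow> complex mat) \<Rightarrow> real measure" where
  "outcome_dist \<rho> M = measure_of UNIV (sets borel) (\<lambda>A. ennreal (Re (mtrace (\<rho> * M A))))"

text \<open>The model: rho :: real => complex mat (values outside Theta irrelevant).\<close>
definition qmodel :: "nat \<Rightarrow> real set \<Rightarrow> (real \<Rightarrow> complex mat) \<Rightarrow> bool" where
  "qmodel d \<Theta> \<rho> \<longleftrightarrow> 0 < d \<and> (\<forall>\<theta>\<in>\<Theta>. density_pos d (\<rho> \<theta>))"

definition Dq :: "real \<Rightarrow> real \<Rightarrow> (real \<Rightarrow> real) \<Rightarrow> real \<Rightarrow> real" where
  "Dq t \<delta> f \<theta> = (f (\<theta> + t * \<delta>) - f (\<theta> - (1 - t) * \<delta>)) / \<delta>"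

definition Dq_tpow :: "real \<Rightarrow> real \<Rightarrow> (real \<Rightarrow> complex mat) \<Rightarrow> nat \<Rightarrow> real \<Rightarrow> complex mat" where
  "Dq_tpow t \<delta> \<rho> n \<theta> =
     complex_of_real (1 / \<delta>) \<cdot>\<^sub>m (tpow (\<rho> (\<theta> + t * \<delta>)) n - tpow (\<rho> (\<theta> - (1 - t) * \<delta>)) n)"

definition LR :: "nat \<Rightarrow> (real \<Rightarrow> complex mat) \<Rightarrow> nat \<Rightarrow> real \<Rightarrow> real \<Rightarrow> real \<Rightarrow> complex mat" where
  "LR d \<rho> n t \<theta> \<delta> = (THE L. L \<in> carrier_mat (d ^ n) (d ^ n) \<and>
       Dq_tpow t \<delta> \<rho> n \<theta> = tpow (\<rho> \<theta>) n * L)"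

definition JR :: "nat \<Rightarrow> (real \<Rightarrow> complex mat) \<Rightarrow> (nat \<Rightarrow> real) \<Rightarrow> real \<Rightarrow> real \<Rightarrow> ereal" where
  "JR d \<rho> c t \<theta> = Limsup (at_right 0) (\<lambda>h. limsup (\<lambda>n.
      ereal (Re (mtrace (tpow (\<rho> \<theta>) n * LR d \<rho> n t \<theta> (h / c n) * adj (LR d \<rho> n t \<theta> (h / c n))))
             / (c n)\<^sup>2)))"

text \<open>Bias b(M_n, theta') (Lebesgue integral; only meaningful when integrable).\<close>
definition bias :: "(real \<Rightarrow> complex mat) \<Rightarrow> (real \<Rightarrow> real) \<Rightarrow> nat \<Rightarrow> (real set \<Rightarrow> complex mat) \<Rightarrow> real \<Rightarrow> real" where
  "bias \<rho> g n M \<theta>' = (\<integral>\<gamma>. (\<gamma> - g \<theta>') \<partial>(outcome_dist (tpow (\<rho> \<theta>') n) M))"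

definition bias_defined :: "(real \<Rightarrow> complex mat) \<Rightarrow> (real \<Rightarrow> real) \<Rightarrow> nat \<Rightarrow> (real set \<Rightarrow> complex mat) \<Rightarrow> real \<Rightarrow> bool" where
  "bias_defined \<rho> g n M \<theta>' \<longleftrightarrow> integrable (outcome_dist (tpow (\<rho> \<theta>') n) M) (\<lambda>\<gamma>. \<gamma> - g \<theta>')"

definition mse :: "(real \<Rightarrow> complex mat) \<Rightarrow> (real \<Rightarrow> real) \<Rightarrow> nat \<Rightarrow> (real set \<Rightarrow> complex mat) \<Rightarrow> real \<Rightarrow> ereal" where
  "mse \<rho> g n M \<theta>' = enn2ereal (\<integral>\<^sup>+\<gamma>. ennreal ((\<gamma> - g \<theta>')\<^sup>2) \<partial>(outcome_dist (tpow (\<rho> \<theta>') n) M))"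

definition cn_unbiased_right :: "(real \<Rightarrow> complex mat) \<Rightarrow> (real \<Rightarrow> real) \<Rightarrow> (nat \<Rightarrow> real) \<Rightarrow> (nat \<Rightarrow> real set \<Rightarrow> complex mat) \<Rightarrow> real \<Rightarrow> bool" where
  "cn_unbiased_right \<rho> g c M \<theta> \<longleftrightarrow> (\<exists>h0>0. \<forall>h. 0 \<le> h \<and> h < h0 \<longrightarrow>
     (\<forall>\<^sub>F n in sequentially. bias_defined \<rho> g n (M n) (\<theta> + h / c n)) \<and>
     ((\<lambda>n. c n * bias \<rho> g n (M n) (\<theta> + h / c n)) \<longlonglongrightarrow> 0))"

definition cn_unbiased_left :: "(real \<Rightarrow> complex mat) \<Rightarrow> (real \<Rightarrow> real) \<Rightarrow> (nat \<Rightarrow> real) \<Rightarrow> (nat \<Rightarrow> real set \<Rightarrow> complex mat) \<Rightarrow> real \<Rightarrow> bool" where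
  "cn_unbiased_left \<rho> g c M \<theta> \<longleftrightarrow> (\<exists>h0>0. \<forall>h. 0 \<le> h \<and> h < h0 \<longrightarrow>
     (\<forall>\<^sub>F n in sequentially. bias_defined \<rho> g n (M n) (\<theta> - h / c n)) \<and>
     ((\<lambda>n. c n * bias \<rho> g n (M n) (\<theta> - h / c n)) \<longlonglongrightarrow> 0))"

end

theory Submission
  imports Defs "Jordan_Normal_Form.Determinant"
begin

text \<open>
  Write \<sigma> and \<tau> for the n-fold states at \<theta> and at the shifted parameter, and let
  \<tau> - \<sigma> = \<sigma> K. For every real u the operator (K - u)* \<sigma> (K - u) = K* \<sigma> K - 2 u (\<tau> - \<sigma>) + u^2 \<sigma> is
  positive, so the outcome distributions \<kappa>, \<nu>, \<mu> of K* \<sigma> K, \<tau>, \<sigma> satisfy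
  \<kappa>(A) - 2 u (\<nu>(A) - \<mu>(A)) + u^2 \<mu>(A) \<ge> 0 on every Borel set. This integrates to the Cauchy-Schwarz
  bound (\<integral>f d\<nu> - \<integral>f d\<mu>)^2 \<le> Tr(\<sigma> K K*) \<integral>f^2 d\<mu>. For f = \<gamma> - g(\<theta>) and shift h / c_n, the left side
  times c_n^2 tends to (h g'_t(\<theta>))^2 by asymptotic unbiasedness, and the right side is h^2 times the
  n-th term defining J times c_n^2 V. The limits n \<rightarrow> \<infinity> and then h \<rightarrow> 0+ give the theorem.
\<close>

section \<open>Positive semidefinite matrices\<close>

text \<open>Coefficients and vectors are total functions of which only the indices below
  \<open>N\<close> are read, so elimination can change a matrix entrywise without carrier
  conditions.\<close>

definition herm_form :: "nat \<Rightarrow> (nat \<Rightarrow> nat \<Rightarrow> complex) \<Rightarrow> (nat \<Rightarrow> complex) \<Rightarrow> complex" where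
  "herm_form N a x = (\<Sum>i<N. \<Sum>j<N. cnj (x i) * a i j * x j)"

lemma herm_form_cong:
  assumes "\<And>i j. i < N \<Longrightarrow> j < N \<Longrightarrow> a i j = b i j"
  shows "herm_form N a x = herm_form N b x"
  unfolding herm_form_def using assms by (intro sum.cong) auto

lemma herm_form_diff:
  "herm_form N (\<lambda>i j. a i j - b i j) x = herm_form N a x - herm_form N b x"
  unfolding herm_form_def by (simp add: algebra_simps sum_subtractf)

lemma cnj_mult_self: "cnj z * z = of_real ((cmod z)\<^sup>2)"
  by (metis complex_norm_square mult.commute)

lemma herm_form_rank_one:
  "herm_form N (\<lambda>i j. c * (w i * cnj (w j))) x = c * (cmod (\<Sum>j<N. cnj (w j) * x j))\<^sup>2"
proof -
  have "herm_form N (\<lambda>i j. c * (w i * cnj (w j))) x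
      = (\<Sum>i<N. \<Sum>j<N. c * ((w i * cnj (x i)) * (cnj (w j) * x j)))"
    unfolding herm_form_def by (intro sum.cong refl) (simp add: ac_simps)
  also have "\<dots> = c * ((\<Sum>i<N. w i * cnj (x i)) * (\<Sum>j<N. cnj (w j) * x j))"
    unfolding sum_product by (simp only: sum_distrib_left)
  also have "(\<Sum>i<N. w i * cnj (x i)) = cnj (\<Sum>j<N. cnj (w j) * x j)"
    by simp
  finally show ?thesis
    by (simp only: cnj_mult_self)
qed

text \<open>Changing the single coordinate \<open>m\<close> by \<open>z\<close> makes the form a
  quadratic polynomial in \<open>z\<close>. Hermitian symmetry makes the two cross terms conjugate
  to each other, both governed by the row product \<open>b\<close>.\<close>

lemma herm_form_add_unit:
  fixes x :: "nat \<Rightarrow> complex"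
  assumes herm: "\<And>i j. i < N \<Longrightarrow> j < N \<Longrightarrow> a j i = cnj (a i j)" and m: "m < N"
    and b: "b = (\<Sum>j<N. a m j * x j)"
  shows "herm_form N a (\<lambda>i. x i + (if i = m then z else 0))
       = herm_form N a x + cnj z * b + z * cnj b + cnj z * z * a m m"
proof -
  define e where "e = (\<lambda>i. if i = m then z else 0)"
  have ce: "cnj (e i) = (if i = m then cnj z else 0)" for i by (simp add: e_def)
  have "herm_form N a (\<lambda>i. x i + e i) = herm_form N a x
     + (\<Sum>i<N. \<Sum>j<N. cnj (e i) * a i j * x j) + (\<Sum>i<N. \<Sum>j<N. cnj (x i) * a i j * e j)
     + (\<Sum>i<N. \<Sum>j<N. cnj (e i) * a i j * e j)"
    unfolding herm_form_def by (simp add: algebra_simps sum.distrib)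
  moreover have "(\<Sum>i<N. \<Sum>j<N. cnj (e i) * a i j * x j) = cnj z * b"
  proof -
    have "(\<Sum>i<N. \<Sum>j<N. cnj (e i) * a i j * x j) = (\<Sum>i<N. cnj (e i) * (\<Sum>j<N. a i j * x j))"
      by (simp add: sum_distrib_left ac_simps)
    also have "\<dots> = (\<Sum>i<N. if i = m then cnj z * b else 0)"
      by (intro sum.cong) (auto simp: ce b)
    finally show ?thesis using m by simp
  qed
  moreover have "(\<Sum>i<N. \<Sum>j<N. cnj (x i) * a i j * e j) = z * cnj b"
  proof -
    have "(\<Sum>j<N. cnj (x i) * a i j * e j) = cnj (x i) * a i m * z" for i
    proof -
      have "(\<Sum>j<N. cnj (x i) * a i j * e j) = (\<Sum>j<N. if j = m then cnj (x i) * a i m * z else 0)"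
        by (intro sum.cong) (auto simp: e_def)
      then show ?thesis using m by simp
    qed
    then have "(\<Sum>i<N. \<Sum>j<N. cnj (x i) * a i j * e j) = (\<Sum>i<N. z * (cnj (a m i * x i)))"
      using herm[OF m] by (intro sum.cong) (simp_all add: ac_simps)
    then show ?thesis by (simp add: b sum_distrib_left)
  qed
  moreover have "(\<Sum>i<N. \<Sum>j<N. cnj (e i) * a i j * e j) = cnj z * z * a m m"
  proof -
    have "(\<Sum>j<N. cnj (e i) * a i j * e j) = cnj (e i) * a i m * z" for i
    proof -
      have "(\<Sum>j<N. cnj (e i) * a i j * e j) = (\<Sum>j<N. if j = m then cnj (e i) * a i m * z else 0)"
        by (intro sum.cong) (auto simp: e_def)
      then show ?thesis using m by simp
    qed
    then have "(\<Sum>i<N. \<Sum>j<N. cnj (e i) * a i j * e j) = (\<Sum>i<N. if i = m then cnj z * z * a m m else 0)"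
      by (intro sum.cong) (auto simp: ce)
    then show ?thesis using m by simp
  qed
  ultimately show ?thesis by (simp add: e_def)
qed

text \<open>Cholesky elimination, one row and column at a time.\<close>
lemma psd_rank_one_decomposition_aux:
  assumes "r \<le> N"
    and "\<And>i j. i < N \<Longrightarrow> j < N \<Longrightarrow> a j i = cnj (a i j)"
    and "\<And>x. 0 \<le> Re (herm_form N a x)"
    and "\<And>i j. i < N \<Longrightarrow> j < N \<Longrightarrow> i < N - r \<or> j < N - r \<Longrightarrow> a i j = 0"
  shows "\<exists>w. \<forall>i<N. \<forall>j<N. a i j = (\<Sum>k<r. w k i * cnj (w k j))"
  using assms
proof (induction r arbitrary: a)
  case 0
  then show ?case by auto
next
  case (Suc r)
  note herm = Suc.prems(2) and pos = Suc.prems(3)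
  \<comment> \<open>The pivot index: all rows and columns before \<open>m\<close> already
    vanish.\<close>
  define m where "m = N - Suc r"
  have m: "m < N" using Suc.prems(1) by (simp add: m_def)
  define \<alpha> where "\<alpha> = Re (a m m)"
  have "a m m = cnj (a m m)" using herm m by blast
  then have \<alpha>: "a m m = of_real \<alpha>"
    by (metis Reals_cnj_iff \<alpha>_def of_real_Re)
  define b where "b = (\<lambda>x. \<Sum>j<N. a m j * x j)"
  have shift: "0 \<le> Re (herm_form N a x) + 2 * Re (cnj z * b x) + (cmod z)\<^sup>2 * \<alpha>" for x z
  proof -
    have "Re (z * cnj (b x)) = Re (cnj z * b x)" by simp
    moreover have "cnj z * z * a m m = of_real ((cmod z)\<^sup>2 * \<alpha>)"
      unfolding \<alpha> by (simp only: cnj_mult_self of_real_mult)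
    moreover have "herm_form N a (\<lambda>i. x i + (if i = m then z else 0))
       = herm_form N a x + cnj z * b x + z * cnj (b x) + cnj z * z * a m m"
      by (rule herm_form_add_unit[OF herm m]) (simp_all add: b_def)
    moreover have "0 \<le> Re (herm_form N a (\<lambda>i. x i + (if i = m then z else 0)))"
      by (rule pos)
    ultimately show ?thesis by (simp only: plus_complex.sel Re_complex_of_real)
  qed
  have "0 \<le> \<alpha>"
    using shift[of "\<lambda>_. 0" 1] by (simp add: herm_form_def b_def)
  have re: "Re (cnj (of_real s * u) * u) = s * (cmod u)\<^sup>2" for s u
    unfolding cmod_power2 by (simp add: power2_eq_square algebra_simps)
  \<comment> \<open>Cauchy-Schwarz for the form between \<open>x\<close> and the unit vector at
    \<open>m\<close>, obtained by choosing \<open>z\<close> in \<open>shift\<close>.\<close>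
  have bound: "(cmod (b x))\<^sup>2 \<le> \<alpha> * Re (herm_form N a x)" for x
  proof (cases "\<alpha> = 0")
    case True
    have "s * (2 * (cmod (b x))\<^sup>2) \<le> Re (herm_form N a x)" for s
      using shift[of x "of_real (- s) * b x"] unfolding re True by (simp add: algebra_simps)
    \<comment> \<open>With zero pivot the inequality is linear in \<open>s\<close>. If
      \<open>b x\<close> were nonzero, this \<open>s\<close> would make the left side exceed the
      right by 1.\<close>
    from this[of "(Re (herm_form N a x) + 1) / (2 * (cmod (b x))\<^sup>2)"] have "b x = 0"
      by (cases "b x = 0") auto
    then show ?thesis using True by simp
  next
    case False
    with \<open>0 \<le> \<alpha>\<close> have "\<alpha> > 0" by simp
    \<comment> \<open>For a positive pivot the minimizing shift is z = - b x / \<alpha>.\<close>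
    have "(cmod (of_real (- inverse \<alpha>) * b x))\<^sup>2 * \<alpha> = inverse \<alpha> * (cmod (b x))\<^sup>2"
      using \<open>\<alpha> > 0\<close> by (simp add: norm_mult norm_inverse power_mult_distrib power2_eq_square)
    then have "0 \<le> Re (herm_form N a x) - inverse \<alpha> * (cmod (b x))\<^sup>2"
      using shift[of x "of_real (- inverse \<alpha>) * b x"] unfolding re by linarith
    then show ?thesis using \<open>\<alpha> > 0\<close> by (simp add: field_simps)
  qed
  have zero: "a m i = 0" if "\<alpha> = 0" "i < N" for i
  proof -
    have "b (\<lambda>j. if j = i then 1 else 0) = (\<Sum>j<N. if j = i then a m i else 0)"
      unfolding b_def by (intro sum.cong) auto
    then have "b (\<lambda>j. if j = i then 1 else 0) = a m i" using that by simp
    then show ?thesis using bound[of "\<lambda>j. if j = i then 1 else 0"] that by simp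
  qed
  \<comment> \<open>The next Cholesky column. For a zero pivot, division by zero makes it the zero
    vector, which is correct because \<open>zero\<close> says that row \<open>m\<close> then
    vanishes.\<close>
  define v where "v = (\<lambda>i. a i m / of_real (sqrt \<alpha>))"
  define a' where "a' = (\<lambda>i j. a i j - v i * cnj (v j))"
  have vv: "v i * cnj (v j) = of_real (inverse \<alpha>) * (cnj (a m i) * cnj (cnj (a m j)))" if "i < N" "j < N" for i j
  proof -
    have "of_real (sqrt \<alpha>) * of_real (sqrt \<alpha>) = (of_real \<alpha> :: complex)"
      using \<open>0 \<le> \<alpha>\<close> by (simp flip: of_real_mult)
    moreover have "a i m = cnj (a m i)" "a j m = cnj (a m j)" using herm[OF m] that by blast+
    moreover have "v i * cnj (v j) = a i m * cnj (a j m) / (of_real (sqrt \<alpha>) * of_real (sqrt \<alpha>))"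
      by (simp add: v_def)
    ultimately show ?thesis by (simp add: divide_inverse mult.commute)
  qed
  have "\<exists>w. \<forall>i<N. \<forall>j<N. a' i j = (\<Sum>k<r. w k i * cnj (w k j))"
  proof (rule Suc.IH)
    show "r \<le> N" using Suc.prems(1) by simp
    show "a' j i = cnj (a' i j)" if "i < N" "j < N" for i j
      using herm[OF that] by (simp add: a'_def)
    \<comment> \<open>The Schur complement stays positive: removing the rank-one term costs
      \<open>inverse \<alpha> * (cmod (b x))\<^sup>2\<close>, which \<open>bound\<close>
      controls.\<close>
    show "0 \<le> Re (herm_form N a' x)" for x
    proof -
      have "herm_form N a' x = herm_form N a x -
          herm_form N (\<lambda>i j. of_real (inverse \<alpha>) * (cnj (a m i) * cnj (cnj (a m j)))) x"
        unfolding herm_form_diff[symmetric] by (intro herm_form_cong) (simp only: a'_def vv)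
      also have "\<dots> = herm_form N a x - of_real (inverse \<alpha>) * (cmod (b x))\<^sup>2"
        unfolding herm_form_rank_one b_def by simp
      finally have "Re (herm_form N a' x) = Re (herm_form N a x) - inverse \<alpha> * (cmod (b x))\<^sup>2"
        by (simp flip: of_real_mult of_real_power)
      moreover have "inverse \<alpha> * (cmod (b x))\<^sup>2 \<le> inverse \<alpha> * (\<alpha> * Re (herm_form N a x))"
        using bound[of x] \<open>0 \<le> \<alpha>\<close> by (intro mult_left_mono) auto
      moreover have "inverse \<alpha> * (\<alpha> * Re (herm_form N a x)) \<le> Re (herm_form N a x)"
        using pos[of x] by (cases "\<alpha> = 0") (auto simp flip: mult.assoc)
      ultimately show ?thesis by linarith
    qed
    show "a' i j = 0" if ij: "i < N" "j < N" and "i < N - r \<or> j < N - r" for i j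
    proof -
      \<comment> \<open>One of the indices lies before the pivot, where both \<open>a\<close> and
        the correction vanish, or equals it, where the correction cancels the entry.\<close>
      have "i < m \<or> j < m \<or> i = m \<or> j = m" using that Suc.prems(1) by (auto simp: m_def)
      moreover have "a' i j = 0" if "i < m \<or> j < m"
      proof -
        have "a i j = 0" using Suc.prems(4) ij that by (auto simp: m_def)
        moreover have "a i m = 0 \<or> a j m = 0"
          using Suc.prems(4) ij m that by (auto simp: m_def)
        ultimately show ?thesis by (auto simp: a'_def v_def)
      qed
      moreover have "a' i m = 0" if "i < N" for i
        using zero[of i] herm[OF m that] \<alpha> m that unfolding a'_def vv[OF that m]
        by (cases "\<alpha> = 0") auto
      moreover have "a' m j = 0" if "j < N" for j
        using zero[of j] \<alpha> m that unfolding a'_def vv[OF m that]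
        by (cases "\<alpha> = 0") auto
      ultimately show ?thesis using ij by blast
    qed
  qed
  then obtain w where w: "\<And>i j. i < N \<Longrightarrow> j < N \<Longrightarrow> a' i j = (\<Sum>k<r. w k i * cnj (w k j))"
    by blast
  have "a i j = (\<Sum>k<Suc r. (w(r := v)) k i * cnj ((w(r := v)) k j))" if "i < N" "j < N" for i j
  proof -
    have "(\<Sum>k<r. (w(r := v)) k i * cnj ((w(r := v)) k j)) = (\<Sum>k<r. w k i * cnj (w k j))"
      by (intro sum.cong) auto
    then show ?thesis using w[OF that] by (simp add: a'_def algebra_simps)
  qed
  then show ?case by blast
qed

lemma qform_vec: "qform A (vec N x) = herm_form N (\<lambda>i j. A $$ (i,j)) x"
  unfolding qform_def herm_form_def by (intro sum.cong) auto

lemma hermitian_index: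
  assumes "hermitian N A" "i < N" "j < N"
  shows "A $$ (j,i) = cnj (A $$ (i,j))"
proof -
  have "adj A = A" and A: "A \<in> carrier_mat N N" using assms(1) by (auto simp: hermitian_def)
  have "adj A $$ (j,i) = cnj (A $$ (i,j))" using A assms(2,3) by (auto simp: adj_def)
  then show ?thesis using \<open>adj A = A\<close> by simp
qed

lemma pos_semidefD:
  assumes "pos_semidef N A"
  shows "A \<in> carrier_mat N N" "hermitian N A" "0 \<le> Re (herm_form N (\<lambda>i j. A $$ (i,j)) x)"
  using assms unfolding pos_semidef_def hermitian_def by (auto simp flip: qform_vec)

text \<open>Elimination with \<open>r = N\<close>, where no row has to vanish in advance.\<close>

lemma psd_rank_one_decomposition:
  assumes "pos_semidef N A"
  obtains w where "\<And>i j. i < N \<Longrightarrow> j < N \<Longrightarrow> A $$ (i,j) = (\<Sum>k<N. w k i * cnj (w k j))"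
proof -
  have "\<exists>w. \<forall>i<N. \<forall>j<N. A $$ (i,j) = (\<Sum>k<N. w k i * cnj (w k j))"
    by (rule psd_rank_one_decomposition_aux)
      (rule order_refl hermitian_index[OF pos_semidefD(2)[OF assms]] pos_semidefD(3)[OF assms]
        | assumption | simp)+
  then show ?thesis using that by blast
qed

section \<open>Traces of products\<close>

lemma index_mult_sum:
  assumes "A \<in> carrier_mat n m" "B \<in> carrier_mat m p" "i < n" "j < p"
  shows "(A * B) $$ (i,j) = (\<Sum>k<m. A $$ (i,k) * B $$ (k,j))"
  using assms by (auto simp: scalar_prod_def atLeast0LessThan)

lemma mtrace_mult:
  assumes "A \<in> carrier_mat n m" "B \<in> carrier_mat m n"
  shows "mtrace (A * B) = (\<Sum>i<n. \<Sum>j<m. A $$ (i,j) * B $$ (j,i))"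
  using assms index_mult_sum[OF assms] by (auto simp: mtrace_def)

lemma mtrace_mult_commute:
  assumes "A \<in> carrier_mat n m" "B \<in> carrier_mat m n"
  shows "mtrace (A * B) = mtrace (B * A)"
  unfolding mtrace_mult[OF assms] mtrace_mult[OF assms(2,1)]
  by (subst sum.swap) (simp add: mult.commute)

text \<open>Writing \<open>A\<close> as a sum of rank-one terms built from vectors
  \<open>w k\<close> turns the trace into the sum of the values of the form of \<open>B\<close> at
  the \<open>w k\<close>. This makes outcome weights nonnegative.\<close>

lemma mtrace_mult_psd_nonneg:
  assumes "pos_semidef N A" "pos_semidef N B"
  shows "0 \<le> Re (mtrace (A * B))"
proof -
  obtain w where w: "\<And>i j. i < N \<Longrightarrow> j < N \<Longrightarrow> A $$ (i,j) = (\<Sum>k<N. w k i * cnj (w k j))"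
    using psd_rank_one_decomposition[OF assms(1)] by blast
  have "mtrace (A * B) = (\<Sum>i<N. \<Sum>j<N. \<Sum>k<N. w k i * cnj (w k j) * B $$ (j,i))"
    unfolding mtrace_mult[OF pos_semidefD(1)[OF assms(1)] pos_semidefD(1)[OF assms(2)]]
    by (simp add: w sum_distrib_right)
  also have "\<dots> = (\<Sum>i<N. \<Sum>k<N. \<Sum>j<N. w k i * cnj (w k j) * B $$ (j,i))"
    by (rule sum.cong[OF refl], rule sum.swap)
  also have "\<dots> = (\<Sum>k<N. \<Sum>i<N. \<Sum>j<N. w k i * cnj (w k j) * B $$ (j,i))"
    by (rule sum.swap)
  also have "\<dots> = (\<Sum>k<N. \<Sum>j<N. \<Sum>i<N. w k i * cnj (w k j) * B $$ (j,i))"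
    by (rule sum.cong[OF refl], rule sum.swap)
  also have "\<dots> = (\<Sum>k<N. herm_form N (\<lambda>i j. B $$ (i,j)) (w k))"
    unfolding herm_form_def by (intro sum.cong refl) simp
  finally show ?thesis
    using pos_semidefD(3)[OF assms(2)] by (simp add: sum_nonneg)
qed

section \<open>Adjoints, congruence and factorization\<close>

lemma adj_dim [simp]: "dim_row (adj A) = dim_col A" "dim_col (adj A) = dim_row A"
  by (auto simp: adj_def)

lemma adj_carrier [simp]: "adj A \<in> carrier_mat n m \<longleftrightarrow> A \<in> carrier_mat m n"
  by (metis adj_dim carrier_matD carrier_matI)

lemma adj_index: "i < dim_col A \<Longrightarrow> j < dim_row A \<Longrightarrow> adj A $$ (i,j) = cnj (A $$ (j,i))"
  by (simp add: adj_def)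

lemma adj_adj [simp]: "adj (adj A) = A"
  by (rule eq_matI) (auto simp: adj_index)

lemma adj_one [simp]: "adj (1\<^sub>m n) = 1\<^sub>m n"
  by (rule eq_matI) (auto simp: adj_index)

lemma adj_mult:
  assumes "A \<in> carrier_mat n m" "B \<in> carrier_mat m p"
  shows "adj (A * B) = adj B * adj A"
  by (rule eq_matI) (use assms in \<open>auto simp: adj_index scalar_prod_def ac_simps\<close>)

lemma adj_minus:
  assumes "A \<in> carrier_mat n m" "B \<in> carrier_mat n m"
  shows "adj (A - B) = adj A - adj B"
  by (rule eq_matI) (use assms in \<open>auto simp: adj_index\<close>)

lemma adj_smult: "adj (c \<cdot>\<^sub>m A) = cnj c \<cdot>\<^sub>m adj A"
  by (rule eq_matI) (auto simp: adj_index)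

lemma mtrace_smult: "mtrace (c \<cdot>\<^sub>m A) = c * mtrace A" if "A \<in> carrier_mat n n"
  using that by (auto simp: mtrace_def sum_distrib_left)

lemma qform_mult_mat_vec:
  assumes "A \<in> carrier_mat N N" "v \<in> carrier_vec N"
  shows "qform A v = (\<Sum>i<N. cnj (v $ i) * (A *\<^sub>v v) $ i)"
  using assms by (auto simp: qform_def scalar_prod_def atLeast0LessThan sum_distrib_left mult.assoc
      intro!: sum.cong)

lemma qform_congruence:
  assumes A: "A \<in> carrier_mat N N" and K: "K \<in> carrier_mat N m" and v: "v \<in> carrier_vec m"
  shows "qform (adj K * A * K) v = qform A (K *\<^sub>v v)"
proof -
  define z where "z = A *\<^sub>v (K *\<^sub>v v)"
  have z: "z \<in> carrier_vec N" using assms by (auto simp: z_def)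
  have "(adj K * A * K) *\<^sub>v v = adj K *\<^sub>v z"
    using assms assoc_mult_mat_vec[of "adj K" m N "A * K" m v] assoc_mult_mat_vec[of A N N K m v]
    by (simp add: z_def assoc_mult_mat[of _ m N _ N _ m])
  then have "qform (adj K * A * K) v = (\<Sum>p<m. cnj (v $ p) * (adj K *\<^sub>v z) $ p)"
    by (subst qform_mult_mat_vec[where N = m]) (use assms in auto)
  also have "\<dots> = (\<Sum>p<m. \<Sum>i<N. cnj (v $ p) * (cnj (K $$ (i,p)) * z $ i))"
    using K v z by (intro sum.cong refl)
      (auto simp: scalar_prod_def atLeast0LessThan sum_distrib_left adj_index intro!: sum.cong)
  also have "\<dots> = (\<Sum>i<N. \<Sum>p<m. cnj (v $ p) * (cnj (K $$ (i,p)) * z $ i))"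
    by (rule sum.swap)
  also have "\<dots> = (\<Sum>i<N. cnj ((K *\<^sub>v v) $ i) * z $ i)"
    using K v by (intro sum.cong refl)
      (auto simp: scalar_prod_def atLeast0LessThan sum_distrib_left ac_simps intro!: sum.cong)
  also have "\<dots> = qform A (K *\<^sub>v v)"
    unfolding z_def by (rule qform_mult_mat_vec[symmetric]) (use assms in auto)
  finally show ?thesis .
qed

lemma pos_semidef_congruence:
  assumes "pos_semidef N A" "K \<in> carrier_mat N m"
  shows "pos_semidef m (adj K * A * K)"
proof -
  have A: "A \<in> carrier_mat N N" "adj A = A" and pos: "\<And>v. v \<in> carrier_vec N \<Longrightarrow> 0 \<le> Re (qform A v)"
    using assms(1) by (auto simp: pos_semidef_def hermitian_def)
  have "adj (adj K * A * K) = adj K * adj (adj K * A)"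
    using assms(2) A by (intro adj_mult[of _ m N _ m]) auto
  also have "adj (adj K * A) = A * K"
    using assms(2) A by (simp add: adj_mult[of "adj K" m N A N])
  also have "adj K * (A * K) = adj K * A * K"
    using assms(2) A by (intro assoc_mult_mat[symmetric]) auto
  finally have "adj (adj K * A * K) = adj K * A * K" .
  then show ?thesis
    using assms(2) A(1) pos
    by (auto simp: pos_semidef_def hermitian_def qform_congruence simp del: assoc_mult_mat)
qed

lemma pos_semidef_one: "pos_semidef N (1\<^sub>m N)"
proof -
  have "Re (qform (1\<^sub>m N) v) = (\<Sum>i<N. (cmod (v $ i))\<^sup>2)" if "v \<in> carrier_vec N" for v
    unfolding qform_mult_mat_vec[OF one_carrier_mat that] using that
    by (simp only: one_mult_mat_vec Re_sum cnj_mult_self Re_complex_of_real)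
  then show ?thesis
    by (auto simp: pos_semidef_def hermitian_def intro!: sum_nonneg)
qed

text \<open>The vectors of the rank-one decomposition are the columns of \<open>W\<close>. Such a
  factorization passes directly to tensor powers.\<close>

lemma pos_semidef_factor:
  assumes "pos_semidef N A"
  obtains W where "W \<in> carrier_mat N N" "A = W * adj W"
proof -
  obtain w where w: "\<And>i j. i < N \<Longrightarrow> j < N \<Longrightarrow> A $$ (i,j) = (\<Sum>k<N. w k i * cnj (w k j))"
    using psd_rank_one_decomposition[OF assms] by blast
  define W where "W = mat N N (\<lambda>(i,k). w k i)"
  have "A = W * adj W"
    by (rule eq_matI) (use pos_semidefD(1)[OF assms] in
        \<open>auto simp: W_def w adj_index scalar_prod_def atLeast0LessThan\<close>)
  then show ?thesis using that[of W] by (simp add: W_def)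
qed

lemma pos_def_imp_pos_semidef:
  assumes "pos_def N A"
  shows "pos_semidef N A"
proof -
  have "0 \<le> Re (qform A v)" if "v \<in> carrier_vec N" for v
  proof (cases "v = 0\<^sub>v N")
    case True
    then show ?thesis by (simp add: qform_def)
  next
    case False
    then show ?thesis using assms that by (auto simp: pos_def_def intro: less_imp_le)
  qed
  then show ?thesis using assms by (auto simp: pos_semidef_def pos_def_def)
qed

text \<open>A kernel vector would make the form vanish, so the determinant is nonzero.\<close>

lemma pos_def_invertible:
  assumes "pos_def N A"
  obtains B where "B \<in> carrier_mat N N" "A * B = 1\<^sub>m N"
proof -
  have A: "A \<in> carrier_mat N N" using assms by (auto simp: pos_def_def hermitian_def)
  have "det A \<noteq> 0"
  proof
    assume "det A = 0"
    then obtain v where v: "v \<in> carrier_vec N" "v \<noteq> 0\<^sub>v N" "A *\<^sub>v v = 0\<^sub>v N"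
      using det_0_iff_vec_prod_zero_field[OF A] by blast
    then have "qform A v = 0" by (simp add: qform_mult_mat_vec[OF A])
    then show False using assms v by (auto simp: pos_def_def)
  qed
  then have "A \<in> Units (ring_mat TYPE(complex) N ())"
    by (rule det_non_zero_imp_unit[OF A])
  then show ?thesis using that by (auto simp: Units_def ring_mat_def)
qed

section \<open>Tensor powers\<close>

text \<open>Flattens a double sum along \<open>k = i * n + j\<close>, the index convention of
  \<open>kron\<close>.\<close>

lemma sum_div_mod:
  fixes f :: "nat \<Rightarrow> nat \<Rightarrow> 'a :: comm_monoid_add"
  shows "(\<Sum>k<m * n. f (k div n) (k mod n)) = (\<Sum>i<m. \<Sum>j<n. f i j)"
proof (cases "n = 0")
  case False
  have "i * n + j < m * n" if "i < m" "j < n" for i j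
  proof -
    have "i * n + j < Suc i * n" using that by simp
    also have "\<dots> \<le> m * n" using that by (intro mult_le_mono1) simp
    finally show ?thesis .
  qed
  then show ?thesis
    unfolding sum.cartesian_product using False
    by (intro sum.reindex_bij_witness[where i = "\<lambda>(i,j). i * n + j" and j = "\<lambda>k. (k div n, k mod n)"])
      (auto simp: less_mult_imp_div_less)
qed simp

lemma kron_dim [simp]:
  "dim_row (kron A B) = dim_row A * dim_row B" "dim_col (kron A B) = dim_col A * dim_col B"
  by (simp_all add: kron_def)

lemma kron_carrier:
  "A \<in> carrier_mat n m \<Longrightarrow> B \<in> carrier_mat p q \<Longrightarrow> kron A B \<in> carrier_mat (n * p) (m * q)"
  by auto

lemma div_mod_less:
  assumes "(k::nat) < m * n"
  shows "k div n < m" "k mod n < n"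
  using assms by (auto simp: less_mult_imp_div_less) (metis mod_less_divisor mult_is_0 not_gr_zero not_less_zero)

lemma kron_index:
  assumes "i < dim_row A * dim_row B" "j < dim_col A * dim_col B"
  shows "kron A B $$ (i,j) =
    A $$ (i div dim_row B, j div dim_col B) * B $$ (i mod dim_row B, j mod dim_col B)"
  using assms by (simp add: kron_def)

text \<open>The mixed-product rule: the sum over the joint index splits into the product of the sums
  over its quotient and its remainder.\<close>

lemma kron_mult_kron:
  assumes A: "A \<in> carrier_mat n m" and C: "C \<in> carrier_mat m p"
    and B: "B \<in> carrier_mat n' m'" and D: "D \<in> carrier_mat m' p'"
  shows "kron A B * kron C D = kron (A * C) (B * D)"
proof (rule eq_matI)
  fix i j assume "i < dim_row (kron (A * C) (B * D))" "j < dim_col (kron (A * C) (B * D))"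
  then have ij: "i < n * n'" "j < p * p'" using assms by auto
  note ij' = div_mod_less[OF ij(1)] div_mod_less[OF ij(2)]
  define f where "f = (\<lambda>x y. (A $$ (i div n', x) * C $$ (x, j div p')) *
      (B $$ (i mod n', y) * D $$ (y, j mod p')))"
  have "(kron A B * kron C D) $$ (i,j) = (\<Sum>k<m * m'. kron A B $$ (i,k) * kron C D $$ (k,j))"
    by (rule index_mult_sum) (use kron_carrier[OF A B] kron_carrier[OF C D] ij in auto)
  also have "\<dots> = (\<Sum>k<m * m'. f (k div m') (k mod m'))"
    using assms ij by (intro sum.cong) (auto simp: kron_index f_def)
  also have "\<dots> = (\<Sum>x<m. A $$ (i div n', x) * C $$ (x, j div p')) *
      (\<Sum>y<m'. B $$ (i mod n', y) * D $$ (y, j mod p'))"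
    unfolding sum_div_mod by (simp add: sum_product f_def)
  also have "\<dots> = (A * C) $$ (i div n', j div p') * (B * D) $$ (i mod n', j mod p')"
    using index_mult_sum[OF A C ij'(1,3)] index_mult_sum[OF B D ij'(2,4)] by simp
  also have "\<dots> = kron (A * C) (B * D) $$ (i,j)"
    using assms ij by (auto simp: kron_index)
  finally show "(kron A B * kron C D) $$ (i,j) = kron (A * C) (B * D) $$ (i,j)" .
qed (use assms in auto)

lemma kron_one: "kron (1\<^sub>m m) (1\<^sub>m n) = 1\<^sub>m (m * n)"
proof (rule eq_matI)
  fix i j assume "i < dim_row (1\<^sub>m (m * n))" "j < dim_col (1\<^sub>m (m * n))"
  then have ij: "i < m * n" "j < m * n" by auto
  have "i = j \<longleftrightarrow> i div n = j div n \<and> i mod n = j mod n"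
    by (metis div_mult_mod_eq)
  then show "kron (1\<^sub>m m) (1\<^sub>m n) $$ (i,j) = 1\<^sub>m (m * n) $$ (i,j)"
    using ij div_mod_less[OF ij(1)] div_mod_less[OF ij(2)] by (auto simp: kron_index)
qed auto

lemma adj_kron: "adj (kron A B) = kron (adj A) (adj B)"
proof (rule eq_matI)
  fix i j assume "i < dim_row (kron (adj A) (adj B))" "j < dim_col (kron (adj A) (adj B))"
  then have ij: "i < dim_col A * dim_col B" "j < dim_row A * dim_row B" by auto
  show "adj (kron A B) $$ (i,j) = kron (adj A) (adj B) $$ (i,j)"
    using ij div_mod_less[OF ij(1)] div_mod_less[OF ij(2)] by (simp add: kron_index adj_index)
qed auto

lemma mtrace_kron:
  assumes "A \<in> carrier_mat m m" "B \<in> carrier_mat n n"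
  shows "mtrace (kron A B) = mtrace A * mtrace B"
proof -
  define f where "f = (\<lambda>x y. A $$ (x,x) * B $$ (y,y))"
  have "mtrace (kron A B) = (\<Sum>k<m * n. f (k div n) (k mod n))"
    using assms unfolding mtrace_def by (intro sum.cong) (auto simp: kron_index f_def)
  then show ?thesis
    unfolding sum_div_mod using assms by (auto simp: mtrace_def sum_product f_def)
qed

section \<open>Tensor powers of matrices and of states\<close>

lemma tpow_carrier:
  assumes "A \<in> carrier_mat d d"
  shows "tpow A n \<in> carrier_mat (d ^ n) (d ^ n)"
  using assms by (induction n) (auto simp: mult.commute)

lemma tpow_mult:
  assumes "A \<in> carrier_mat d d" "B \<in> carrier_mat d d"
  shows "tpow (A * B) n = tpow A n * tpow B n"
proof (induction n)
  case (Suc n)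
  then show ?case
    using kron_mult_kron[OF tpow_carrier tpow_carrier assms] assms by simp
qed simp

lemma tpow_one: "tpow (1\<^sub>m d) n = 1\<^sub>m (d ^ n)"
  by (induction n) (simp_all add: kron_one mult.commute)

lemma adj_tpow: "adj (tpow A n) = tpow (adj A) n"
  by (induction n) (simp_all add: adj_kron)

lemma mtrace_tpow:
  assumes "A \<in> carrier_mat d d"
  shows "mtrace (tpow A n) = mtrace A ^ n"
proof (induction n)
  case 0
  then show ?case by (simp add: mtrace_def)
next
  case (Suc n)
  then show ?case by (simp add: mtrace_kron[OF tpow_carrier[OF assms] assms] mult.commute)
qed

text \<open>From \<open>A = W * adj W\<close> the tensor power is the product of
  \<open>tpow W n\<close> with its adjoint, hence a congruence of the identity.\<close>

lemma pos_semidef_tpow: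
  assumes "pos_semidef d A"
  shows "pos_semidef (d ^ n) (tpow A n)"
proof -
  obtain W where W: "W \<in> carrier_mat d d" "A = W * adj W"
    using pos_semidef_factor[OF assms] by blast
  define V where "V = adj (tpow W n)"
  have V: "V \<in> carrier_mat (d ^ n) (d ^ n)"
    using tpow_carrier[OF W(1), of n] by (simp add: V_def)
  have "tpow A n = tpow W n * tpow (adj W) n"
    unfolding W(2) by (rule tpow_mult) (use W(1) in auto)
  also have "\<dots> = adj V * 1\<^sub>m (d ^ n) * V"
    using V by (simp add: V_def adj_tpow[symmetric])
  finally show ?thesis
    using pos_semidef_congruence[OF pos_semidef_one V] by simp
qed

text \<open>The inverse is the tensor power of an inverse of \<open>A\<close>; together with
  positivity and unit trace it is what the later bound takes from the state.\<close>

lemma density_pos_tpow: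
  assumes "density_pos d A"
  shows "pos_semidef (d ^ n) (tpow A n)" "mtrace (tpow A n) = 1"
    and "\<exists>B\<in>carrier_mat (d ^ n) (d ^ n). tpow A n * B = 1\<^sub>m (d ^ n)"
proof -
  have pd: "pos_def d A" and tr: "mtrace A = 1" using assms by (auto simp: density_pos_def)
  then have A: "A \<in> carrier_mat d d" by (auto simp: pos_def_def hermitian_def)
  show "pos_semidef (d ^ n) (tpow A n)"
    by (rule pos_semidef_tpow[OF pos_def_imp_pos_semidef[OF pd]])
  show "mtrace (tpow A n) = 1" by (simp add: mtrace_tpow[OF A] tr)
  obtain B where B: "B \<in> carrier_mat d d" "A * B = 1\<^sub>m d" using pos_def_invertible[OF pd] .
  then have "tpow A n * tpow B n = 1\<^sub>m (d ^ n)"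
    by (simp add: tpow_mult[OF A B(1), symmetric] tpow_one)
  then show "\<exists>B\<in>carrier_mat (d ^ n) (d ^ n). tpow A n * B = 1\<^sub>m (d ^ n)"
    using tpow_carrier[OF B(1)] by blast
qed

section \<open>Outcome distributions\<close>

lemma space_outcome_dist [simp]: "space (outcome_dist \<rho> M) = UNIV"
  by (simp add: outcome_dist_def space_measure_of_conv)

lemma sets_outcome_dist [simp, measurable_cong]: "sets (outcome_dist \<rho> M) = sets borel"
  using sets.sigma_sets_eq[of "borel :: real measure"]
  by (simp add: outcome_dist_def sets_measure_of_conv)

lemma povm_carrier:
  assumes "povm N M" "A \<in> sets borel"
  shows "M A \<in> carrier_mat N N"
  using assms pos_semidefD(1) by (auto simp: povm_def)

text \<open>The trace is a finite linear combination of entries of \<open>M\<close>, so entrywise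
  countable additivity carries over.\<close>

lemma povm_sums:
  assumes \<rho>: "\<rho> \<in> carrier_mat N N" and M: "povm N M"
    and F: "range F \<subseteq> sets borel" "disjoint_family F"
  shows "(\<lambda>k. Re (mtrace (\<rho> * M (F k)))) sums Re (mtrace (\<rho> * M (\<Union>k. F k)))"
proof -
  have U: "(\<Union>k. F k) \<in> sets borel" using F by auto
  have "(\<lambda>k. \<Sum>i<N. \<Sum>j<N. \<rho> $$ (i,j) * M (F k) $$ (j,i)) sums
      (\<Sum>i<N. \<Sum>j<N. \<rho> $$ (i,j) * M (\<Union>k. F k) $$ (j,i))"
    using M F by (intro sums_sum sums_mult) (auto simp: povm_def)
  moreover have "F k \<in> sets borel" for k using F by auto
  ultimately have "(\<lambda>k. mtrace (\<rho> * M (F k))) sums mtrace (\<rho> * M (\<Union>k. F k))"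
    by (simp add: mtrace_mult[OF \<rho> povm_carrier[OF M]] U)
  then show ?thesis by (rule sums_Re)
qed

text \<open>\<open>measure_of\<close> takes the intended values once countable additivity is
  checked; nonnegativity of the trace lets \<open>ennreal\<close> commute with the sum. The trace of
  \<rho> is arbitrary, since the result is also applied to
  \<open>adj K * \<sigma> * K\<close>.\<close>

lemma emeasure_outcome_dist:
  assumes \<rho>: "pos_semidef N \<rho>" and M: "povm N M" and A: "A \<in> sets borel"
  shows "emeasure (outcome_dist \<rho> M) A = ennreal (Re (mtrace (\<rho> * M A)))"
proof -
  let ?m = "\<lambda>A. ennreal (Re (mtrace (\<rho> * M A)))"
  have nonneg: "0 \<le> Re (mtrace (\<rho> * M A))" if "A \<in> sets borel" for A
    using M that by (intro mtrace_mult_psd_nonneg[OF \<rho>]) (auto simp: povm_def)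
  note sums = povm_sums[OF pos_semidefD(1)[OF \<rho>] M]
  \<comment> \<open>The empty set has weight zero because additivity on the constant empty sequence
    makes a constant series converge.\<close>
  have "(\<lambda>k::nat. Re (mtrace (\<rho> * M {}))) sums Re (mtrace (\<rho> * M {}))"
    using sums[of "\<lambda>_. {}"] by (simp add: disjoint_family_on_def)
  then have "(\<lambda>k::nat. Re (mtrace (\<rho> * M {}))) \<longlonglongrightarrow> 0"
    by (intro summable_LIMSEQ_zero) (rule sums_summable)
  then have empty: "Re (mtrace (\<rho> * M {})) = 0"
    by (simp add: LIMSEQ_const_iff)
  have "countably_additive (sets borel) ?m"
  proof (rule countably_additiveI)
    fix F :: "nat \<Rightarrow> real set"
    assume F: "range F \<subseteq> sets borel" "disjoint_family F"
    then have "(\<Sum>k. ?m (F k)) = ennreal (\<Sum>k. Re (mtrace (\<rho> * M (F k))))"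
      using sums[OF F] by (intro suminf_ennreal2 nonneg) (auto intro: sums_summable)
    then show "(\<Sum>k. ?m (F k)) = ?m (\<Union>k. F k)"
      using sums[OF F] by (simp add: sums_iff)
  qed
  then show ?thesis
    using A unfolding outcome_dist_def
    by (subst emeasure_measure_of_sigma)
      (auto simp: positive_def empty sets.sigma_algebra_axioms[of borel, simplified])
qed

lemma measure_outcome_dist:
  assumes "pos_semidef N \<rho>" "povm N M" "A \<in> sets borel"
  shows "measure (outcome_dist \<rho> M) A = Re (mtrace (\<rho> * M A))"
proof -
  have "0 \<le> Re (mtrace (\<rho> * M A))"
    using assms by (intro mtrace_mult_psd_nonneg[OF assms(1)]) (auto simp: povm_def)
  then show ?thesis
    unfolding measure_def by (simp add: emeasure_outcome_dist[OF assms])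
qed

lemma finite_measure_outcome_dist:
  assumes "pos_semidef N \<rho>" "povm N M"
  shows "finite_measure (outcome_dist \<rho> M)"
  by (rule finite_measureI) (simp add: emeasure_outcome_dist[OF assms])

lemma measure_outcome_dist_UNIV:
  assumes "pos_semidef N \<rho>" "povm N M"
  shows "measure (outcome_dist \<rho> M) UNIV = Re (mtrace \<rho>)"
  using assms pos_semidefD(1)[OF assms(1)]
  by (simp add: measure_outcome_dist) (simp add: povm_def)

section \<open>From inequalities on sets to inequalities of integrals\<close>

lemma integral_simple_function_comp:
  fixes p :: "'b \<Rightarrow> real"
  assumes "finite_measure M" and s: "simple_function M s"
  shows "(\<integral>x. p (s x) \<partial>M) = (\<Sum>y\<in>s ` space M. p y * measure M (s -` {y} \<inter> space M))"
proof -
  interpret finite_measure M by fact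
  have fin: "finite (s ` space M)" and meas: "\<And>y. y \<in> s ` space M \<Longrightarrow> s -` {y} \<inter> space M \<in> sets M"
    using s by (auto simp: simple_function_def)
  \<comment> \<open>The weight \<open>p\<close> is left free so that the integrals of 1, of
    \<open>s\<close> and of its square all become sums over the same level sets.\<close>
  have "(\<integral>x. p (s x) \<partial>M) = (\<integral>x. (\<Sum>y\<in>s ` space M. p y * indicator (s -` {y} \<inter> space M) x) \<partial>M)"
  proof (rule Bochner_Integration.integral_cong[OF refl])
    fix x assume "x \<in> space M"
    then have "(\<Sum>y\<in>s ` space M. p y * indicator (s -` {y} \<inter> space M) x)
        = (\<Sum>y\<in>s ` space M. if y = s x then p (s x) else 0)"
      by (intro sum.cong) (auto simp: indicator_def)
    then show "p (s x) = (\<Sum>y\<in>s ` space M. p y * indicator (s -` {y} \<inter> space M) x)"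
      using fin \<open>x \<in> space M\<close> by simp
  qed
  also have "\<dots> = (\<Sum>y\<in>s ` space M. \<integral>x. p y * indicator (s -` {y} \<inter> space M) x \<partial>M)"
    using meas by (intro Bochner_Integration.integral_sum integrable_mult_right integrable_real_indicator)
      (auto simp: less_top[symmetric])
  also have "\<dots> = (\<Sum>y\<in>s ` space M. p y * measure M (s -` {y} \<inter> space M))"
    by simp
  finally show ?thesis .
qed

lemma quadratic_nonneg_imp_discriminant:
  fixes Q E V :: real
  assumes "\<And>u. 0 \<le> Q - 2 * u * E + u\<^sup>2 * V" "0 \<le> V"
  shows "E\<^sup>2 \<le> Q * V"
proof (cases "V = 0")
  case True
  \<comment> \<open>With \<open>V = 0\<close> the polynomial is linear in \<open>u\<close>; for
    nonzero \<open>E\<close> the chosen \<open>u\<close> would give it the value -1.\<close>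
  have "E = 0"
    using assms(1)[of "(Q + 1) / (2 * E)"] True by (cases "E = 0") auto
  then show ?thesis using True by simp
next
  case False
  then have "V > 0" using assms(2) by simp
  \<comment> \<open>The value at the minimizer \<open>u = E / V\<close>.\<close>
  have "0 \<le> Q - E\<^sup>2 / V"
    using assms(1)[of "E / V"] \<open>V > 0\<close> by (simp add: power2_eq_square)
  then show ?thesis using \<open>V > 0\<close> by (simp add: field_simps)
qed

text \<open>The hypothesis on sets is linear in the measures once u is replaced by u y on the
  level set of the value y of a simple function, so it passes to integrals.\<close>
lemma square_integral_diff_le:
  fixes f :: "'a \<Rightarrow> real"
  assumes fin: "finite_measure \<kappa>" "finite_measure \<mu>" "finite_measure \<nu>"
    and sets: "sets \<kappa> = sets \<mu>" "sets \<nu> = sets \<mu>"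
    and quad: "\<And>A u. A \<in> sets \<mu> \<Longrightarrow>
      0 \<le> measure \<kappa> A - 2 * u * (measure \<nu> A - measure \<mu> A) + u\<^sup>2 * measure \<mu> A"
    and f: "integrable \<mu> f" "integrable \<nu> f" "integrable \<mu> (\<lambda>x. (f x)\<^sup>2)"
  shows "((\<integral>x. f x \<partial>\<nu>) - (\<integral>x. f x \<partial>\<mu>))\<^sup>2 \<le> measure \<kappa> (space \<kappa>) * (\<integral>x. (f x)\<^sup>2 \<partial>\<mu>)"
proof (rule quadratic_nonneg_imp_discriminant)
  have space: "space \<kappa> = space \<mu>" "space \<nu> = space \<mu>"
    using sets by (auto dest: sets_eq_imp_space_eq)
  have simple: "0 \<le> measure \<kappa> (space \<kappa>) - 2 * u * ((\<integral>x. s x \<partial>\<nu>) - (\<integral>x. s x \<partial>\<mu>)) + u\<^sup>2 * (\<integral>x. (s x)\<^sup>2 \<partial>\<mu>)"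
    if s: "simple_function \<mu> s" for s :: "'a \<Rightarrow> real" and u
  proof -
    have s': "simple_function \<kappa> s" "simple_function \<nu> s"
      using s by (auto simp: simple_function_def sets space)
    let ?A = "\<lambda>y. s -` {y} \<inter> space \<mu>"
    \<comment> \<open>The total mass of \<kappa> is split over the level sets of \<open>s\<close>
      with weight 1, since the first term of the quadratic carries no power of
      \<open>u\<close>.\<close>
    have "measure \<kappa> (space \<kappa>) = (\<integral>x. 1 \<partial>\<kappa>)" by simp
    also have "\<dots> = (\<Sum>y\<in>s ` space \<mu>. measure \<kappa> (?A y))"
      using integral_simple_function_comp[OF fin(1) s'(1), of "\<lambda>_. 1"] by (simp add: space)
    finally have "measure \<kappa> (space \<kappa>) - 2 * u * ((\<integral>x. s x \<partial>\<nu>) - (\<integral>x. s x \<partial>\<mu>)) + u\<^sup>2 * (\<integral>x. (s x)\<^sup>2 \<partial>\<mu>)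
      = (\<Sum>y\<in>s ` space \<mu>. measure \<kappa> (?A y) - 2 * (u * y) * (measure \<nu> (?A y) - measure \<mu> (?A y))
          + (u * y)\<^sup>2 * measure \<mu> (?A y))"
      using integral_simple_function_comp[OF fin(3) s'(2), of "\<lambda>y. y"]
        integral_simple_function_comp[OF fin(2) s, of "\<lambda>y. y"]
        integral_simple_function_comp[OF fin(2) s, of "\<lambda>y. y\<^sup>2"]
      by (simp add: space sum.distrib sum_subtractf sum_distrib_left algebra_simps power_mult_distrib)
    also have "\<dots> \<ge> 0"
      using s by (intro sum_nonneg quad) (auto simp: simple_function_def)
    finally show ?thesis .
  qed
  have "f \<in> borel_measurable \<mu>" using f(1) by simp
  \<comment> \<open>One sequence of simple functions serves both \<mu> and \<nu>. Its domination by
    twice the absolute value of \<open>f\<close> gives domination of the squares by four times the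
    square of \<open>f\<close>.\<close>
  from borel_measurable_implies_sequence_metric[OF this, of 0]
  obtain s where s: "\<And>i. simple_function \<mu> (s i)"
    and lim: "\<And>x. x \<in> space \<mu> \<Longrightarrow> (\<lambda>i. s i x) \<longlonglongrightarrow> f x"
    and bd: "\<And>i x. x \<in> space \<mu> \<Longrightarrow> \<bar>s i x\<bar> \<le> 2 * \<bar>f x\<bar>"
    by (simp add: dist_real_def) metis
  have meas: "s i \<in> borel_measurable \<mu>" "s i \<in> borel_measurable \<nu>" for i
    using borel_measurable_simple_function[OF s] by (auto simp: measurable_cong_sets[OF sets(2) refl])
  have "(\<lambda>i. \<integral>x. s i x \<partial>\<mu>) \<longlonglongrightarrow> (\<integral>x. f x \<partial>\<mu>)"
    by (rule integral_dominated_convergence[where w = "\<lambda>x. 2 * \<bar>f x\<bar>"])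
      (use f lim bd meas in auto)
  moreover have "(\<lambda>i. \<integral>x. s i x \<partial>\<nu>) \<longlonglongrightarrow> (\<integral>x. f x \<partial>\<nu>)"
    by (rule integral_dominated_convergence[where w = "\<lambda>x. 2 * \<bar>f x\<bar>"])
      (use f lim bd meas in \<open>auto simp: space(2)\<close>)
  moreover have "(\<lambda>i. \<integral>x. (s i x)\<^sup>2 \<partial>\<mu>) \<longlonglongrightarrow> (\<integral>x. (f x)\<^sup>2 \<partial>\<mu>)"
  proof (rule integral_dominated_convergence[where w = "\<lambda>x. 4 * (f x)\<^sup>2"])
    have "(s i x)\<^sup>2 \<le> 4 * (f x)\<^sup>2" if "x \<in> space \<mu>" for i x
      using power_mono[OF bd[OF that, of i], of 2] by (simp add: power_mult_distrib)
    then show "AE x in \<mu>. norm ((s i x)\<^sup>2) \<le> 4 * (f x)\<^sup>2" for i by auto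
  qed (use f lim meas in \<open>auto intro!: tendsto_intros\<close>)
  ultimately have lim: "(\<lambda>i. measure \<kappa> (space \<kappa>) - 2 * u * ((\<integral>x. s i x \<partial>\<nu>) - (\<integral>x. s i x \<partial>\<mu>)) + u\<^sup>2 * (\<integral>x. (s i x)\<^sup>2 \<partial>\<mu>))
    \<longlonglongrightarrow> measure \<kappa> (space \<kappa>) - 2 * u * ((\<integral>x. f x \<partial>\<nu>) - (\<integral>x. f x \<partial>\<mu>)) + u\<^sup>2 * (\<integral>x. (f x)\<^sup>2 \<partial>\<mu>)" for u
    by (intro tendsto_intros)
  show "0 \<le> measure \<kappa> (space \<kappa>) - 2 * u * ((\<integral>x. f x \<partial>\<nu>) - (\<integral>x. f x \<partial>\<mu>)) + u\<^sup>2 * (\<integral>x. (f x)\<^sup>2 \<partial>\<mu>)" for u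
    by (rule LIMSEQ_le_const[OF lim]) (use simple[OF s] in auto)
qed simp

section \<open>The finite-difference Cramer-Rao bound\<close>

lemma smult_smult_mat [simp]: "a \<cdot>\<^sub>m (b \<cdot>\<^sub>m A) = (a * b) \<cdot>\<^sub>m (A :: 'a :: semigroup_mult mat)"
  by (rule eq_matI) (auto simp: mult.assoc)

text \<open>Since \<sigma> and \<open>\<sigma> * K\<close> are Hermitian,
  \<open>adj K * \<sigma> = \<sigma> * K\<close>; hence the two cross terms agree and combine to the
  factor \<open>2 * u\<close>.\<close>

lemma mult_shift_expand:
  assumes \<sigma>: "hermitian N \<sigma>" and K: "K \<in> carrier_mat N N" and D: "hermitian N (\<sigma> * K)"
  shows "adj (K - complex_of_real u \<cdot>\<^sub>m 1\<^sub>m N) * \<sigma> * (K - complex_of_real u \<cdot>\<^sub>m 1\<^sub>m N)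
    = (adj K * \<sigma> * K - complex_of_real (2 * u) \<cdot>\<^sub>m (\<sigma> * K)) + complex_of_real (u\<^sup>2) \<cdot>\<^sub>m \<sigma>"
proof -
  have S: "\<sigma> \<in> carrier_mat N N" "adj \<sigma> = \<sigma>" and D': "adj (\<sigma> * K) = \<sigma> * K"
    using \<sigma> D by (auto simp: hermitian_def)
  have comm: "adj K * \<sigma> = \<sigma> * K"
    using D' adj_mult[OF S(1) K] S(2) by simp
  let ?u = "complex_of_real u"
  let ?X = "K - ?u \<cdot>\<^sub>m 1\<^sub>m N"
  have "adj ?X * \<sigma> = (adj K - ?u \<cdot>\<^sub>m 1\<^sub>m N) * \<sigma>"
    using K by (simp add: adj_minus[of _ N N] adj_smult)
  also have "\<dots> = \<sigma> * K - ?u \<cdot>\<^sub>m \<sigma>"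
    using S K by (simp add: minus_mult_distrib_mat[of _ N N] comm mult_smult_assoc_mat[of _ N N])
  finally have "adj ?X * \<sigma> * ?X = (\<sigma> * K - ?u \<cdot>\<^sub>m \<sigma>) * ?X" by simp
  also have "\<dots> = (\<sigma> * K - ?u \<cdot>\<^sub>m \<sigma>) * K - (\<sigma> * K - ?u \<cdot>\<^sub>m \<sigma>) * (?u \<cdot>\<^sub>m 1\<^sub>m N)"
    by (rule mult_minus_distrib_mat[of _ N N _ N]) (use S K in auto)
  also have "(\<sigma> * K - ?u \<cdot>\<^sub>m \<sigma>) * K = adj K * \<sigma> * K - ?u \<cdot>\<^sub>m (\<sigma> * K)"
    using S K by (simp add: minus_mult_distrib_mat[of _ N N] comm mult_smult_assoc_mat[of _ N N])
  also have "(\<sigma> * K - ?u \<cdot>\<^sub>m \<sigma>) * (?u \<cdot>\<^sub>m 1\<^sub>m N) = ?u \<cdot>\<^sub>m ((\<sigma> * K - ?u \<cdot>\<^sub>m \<sigma>) * 1\<^sub>m N)"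
    by (rule mult_smult_distrib[of _ N N _ N]) (use S K in auto)
  also have "(\<sigma> * K - ?u \<cdot>\<^sub>m \<sigma>) * 1\<^sub>m N = \<sigma> * K - ?u \<cdot>\<^sub>m \<sigma>"
    by (rule right_mult_one_mat[of _ N N]) (use S K in auto)
  finally show ?thesis
    by (auto simp: algebra_simps power2_eq_square intro!: eq_matI) (use S K in auto)
qed

text \<open>Pairs the positive operator of \<open>mult_shift_expand\<close> with \<open>M A\<close>,
  which yields the hypothesis \<open>quad\<close> of \<open>square_integral_diff_le\<close>.\<close>

lemma outcome_dist_quadratic:
  assumes \<sigma>: "pos_semidef N \<sigma>" and \<tau>: "pos_semidef N \<tau>" and K: "K \<in> carrier_mat N N"
    and eq: "\<sigma> * K = \<tau> - \<sigma>" and M: "povm N M" and A: "A \<in> sets borel"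
  shows "0 \<le> measure (outcome_dist (adj K * \<sigma> * K) M) A
    - 2 * u * (measure (outcome_dist \<tau> M) A - measure (outcome_dist \<sigma> M) A)
    + u\<^sup>2 * measure (outcome_dist \<sigma> M) A"
proof -
  let ?P = "adj K * \<sigma> * K" and ?X = "K - complex_of_real u \<cdot>\<^sub>m 1\<^sub>m N"
  have P: "pos_semidef N ?P" by (rule pos_semidef_congruence[OF \<sigma> K])
  have c: "\<sigma> \<in> carrier_mat N N" "\<tau> \<in> carrier_mat N N" "M A \<in> carrier_mat N N" "?P \<in> carrier_mat N N"
    using pos_semidefD(1) \<sigma> \<tau> P povm_carrier[OF M A] by blast+
  have "hermitian N (\<tau> - \<sigma>)"
    using pos_semidefD(2)[OF \<sigma>] pos_semidefD(2)[OF \<tau>]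
    by (auto simp: hermitian_def adj_minus[of _ N N])
  then have h: "hermitian N (\<sigma> * K)" by (simp add: eq)
  have "pos_semidef N (adj ?X * \<sigma> * ?X)"
    by (rule pos_semidef_congruence[OF \<sigma>]) (use K in auto)
  then have "0 \<le> Re (mtrace ((adj ?X * \<sigma> * ?X) * M A))"
    using M A by (intro mtrace_mult_psd_nonneg) (auto simp: povm_def)
  also have "mtrace ((adj ?X * \<sigma> * ?X) * M A)
    = mtrace (((?P - complex_of_real (2 * u) \<cdot>\<^sub>m (\<tau> - \<sigma>)) + complex_of_real (u\<^sup>2) \<cdot>\<^sub>m \<sigma>) * M A)"
    unfolding mult_shift_expand[OF pos_semidefD(2)[OF \<sigma>] K h] eq ..
  also have "\<dots> = mtrace (?P * M A) - complex_of_real (2 * u) * (mtrace (\<tau> * M A) - mtrace (\<sigma> * M A))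
      + complex_of_real (u\<^sup>2) * mtrace (\<sigma> * M A)"
  proof -
    define P where "P = ?P"
    have "P \<in> carrier_mat N N" using c by (simp add: P_def)
    then show ?thesis
      unfolding P_def[symmetric] using c
      by (simp add: mtrace_mult[of _ N N] algebra_simps sum.distrib sum_subtractf sum_distrib_left)
  qed
  finally show ?thesis
    by (simp add: measure_outcome_dist[OF _ M A] \<sigma> \<tau> P del: assoc_mult_mat)
qed

text \<open>The left side is the squared difference of the means of \<gamma> - a under \<tau> and
  under \<sigma>: recentring from \<open>b\<close> to \<open>a\<close> adds \<open>b - a\<close>
  because \<tau> has trace one.\<close>

lemma bias_diff_le:
  assumes \<sigma>: "pos_semidef N \<sigma>" "mtrace \<sigma> = 1" and \<tau>: "pos_semidef N \<tau>" "mtrace \<tau> = 1"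
    and K: "K \<in> carrier_mat N N" and eq: "\<sigma> * K = \<tau> - \<sigma>" and M: "povm N M"
    and int: "integrable (outcome_dist \<sigma> M) (\<lambda>\<gamma>. \<gamma> - a)" "integrable (outcome_dist \<tau> M) (\<lambda>\<gamma>. \<gamma> - b)"
    and V: "(\<integral>\<^sup>+\<gamma>. ennreal ((\<gamma> - a)\<^sup>2) \<partial>(outcome_dist \<sigma> M)) = ennreal V" "0 \<le> V"
  shows "((\<integral>\<gamma>. \<gamma> - b \<partial>(outcome_dist \<tau> M)) + (b - a) - (\<integral>\<gamma>. \<gamma> - a \<partial>(outcome_dist \<sigma> M)))\<^sup>2
    \<le> Re (mtrace (\<sigma> * K * adj K)) * V"
proof -
  let ?P = "adj K * \<sigma> * K"
  have P: "pos_semidef N ?P" by (rule pos_semidef_congruence[OF \<sigma>(1) K])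
  interpret \<nu>: finite_measure "outcome_dist \<tau> M" by (rule finite_measure_outcome_dist[OF \<tau>(1) M])
  have "measure (outcome_dist \<tau> M) UNIV = 1"
    by (simp add: measure_outcome_dist_UNIV[OF \<tau>(1) M] \<tau>)
  then have "(\<integral>\<gamma>. (\<gamma> - b) + (b - a) \<partial>(outcome_dist \<tau> M)) = (\<integral>\<gamma>. \<gamma> - b \<partial>(outcome_dist \<tau> M)) + (b - a)"
    using int(2) by (subst Bochner_Integration.integral_add) auto
  then have \<nu>: "(\<integral>\<gamma>. \<gamma> - a \<partial>(outcome_dist \<tau> M)) = (\<integral>\<gamma>. \<gamma> - b \<partial>(outcome_dist \<tau> M)) + (b - a)"
    by simp
  have "integrable (outcome_dist \<tau> M) (\<lambda>\<gamma>. (\<gamma> - b) + (b - a))"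
    using int(2) by (intro Bochner_Integration.integrable_add) auto
  then have int': "integrable (outcome_dist \<tau> M) (\<lambda>\<gamma>. \<gamma> - a)" by simp
  have sq: "has_bochner_integral (outcome_dist \<sigma> M) (\<lambda>\<gamma>. (\<gamma> - a)\<^sup>2) V"
    by (rule has_bochner_integral_nn_integral) (use V in auto)
  \<comment> \<open>Cyclicity turns the total mass of the auxiliary measure into the kind of trace
    that occurs in \<open>JR\<close>.\<close>
  have "mtrace ?P = mtrace (\<sigma> * K * adj K)"
  proof -
    have "\<sigma> \<in> carrier_mat N N" by (rule pos_semidefD(1)[OF \<sigma>(1)])
    then show ?thesis
      using K mtrace_mult_commute[of "adj K" N N "\<sigma> * K"] by simp
  qed
  then show ?thesis
    using square_integral_diff_le[OF finite_measure_outcome_dist[OF P M]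
        finite_measure_outcome_dist[OF \<sigma>(1) M] finite_measure_outcome_dist[OF \<tau>(1) M]
        _ _ outcome_dist_quadratic[OF \<sigma>(1) \<tau>(1) K eq M] int(1) int']
      measure_outcome_dist_UNIV[OF P M] sq
    by (simp add: \<nu> has_bochner_integral_iff)
qed

text \<open>An inverse of the state makes the defining equation uniquely solvable, so the definite
  description in \<open>LR\<close> denotes its solution.\<close>

lemma LR_solves:
  assumes \<rho>: "density_pos d (\<rho> \<theta>)"
    and c: "Dq_tpow t \<delta> \<rho> n \<theta> \<in> carrier_mat (d ^ n) (d ^ n)"
  shows "LR d \<rho> n t \<theta> \<delta> \<in> carrier_mat (d ^ n) (d ^ n)"
    and "tpow (\<rho> \<theta>) n * LR d \<rho> n t \<theta> \<delta> = Dq_tpow t \<delta> \<rho> n \<theta>"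
proof -
  let ?N = "d ^ n" and ?\<sigma> = "tpow (\<rho> \<theta>) n" and ?D = "Dq_tpow t \<delta> \<rho> n \<theta>"
  have \<sigma>: "?\<sigma> \<in> carrier_mat ?N ?N"
    by (rule pos_semidefD(1)[OF density_pos_tpow(1)[OF \<rho>]])
  obtain B where B: "B \<in> carrier_mat ?N ?N" "?\<sigma> * B = 1\<^sub>m ?N"
    using density_pos_tpow(3)[OF \<rho>] by blast
  \<comment> \<open>As a right inverse \<open>B\<close> gives existence of the solution; as a left
    inverse it gives uniqueness.\<close>
  have B': "B * ?\<sigma> = 1\<^sub>m ?N" by (rule mat_mult_left_right_inverse[OF \<sigma> B])
  have "\<exists>!L. L \<in> carrier_mat ?N ?N \<and> ?D = ?\<sigma> * L"
  proof (rule ex1I[of _ "B * ?D"])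
    have "?\<sigma> * (B * ?D) = (?\<sigma> * B) * ?D"
      by (rule assoc_mult_mat[symmetric]) (use \<sigma> B c in auto)
    then show "B * ?D \<in> carrier_mat ?N ?N \<and> ?D = ?\<sigma> * (B * ?D)"
      using B c by simp
  next
    fix L assume L: "L \<in> carrier_mat ?N ?N \<and> ?D = ?\<sigma> * L"
    have "B * (?\<sigma> * L) = (B * ?\<sigma>) * L"
      by (rule assoc_mult_mat[symmetric]) (use \<sigma> B L in auto)
    also have "\<dots> = L" unfolding B' using L by (intro left_mult_one_mat) auto
    finally show "L = B * ?D" using L by simp
  qed
  from theI'[OF this] show "LR d \<rho> n t \<theta> \<delta> \<in> carrier_mat ?N ?N" "?\<sigma> * LR d \<rho> n t \<theta> \<delta> = ?D"
    unfolding LR_def by auto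
qed

text \<open>With e = 2t - 1, the two cases of the theorem are t = 1 (shift to the right) and
  t = 0 (shift to the left), and the displaced parameter is \<theta> + e \<delta>.\<close>
lemma finite_difference_bound:
  assumes te: "t = 1 \<and> e = 1 \<or> t = 0 \<and> e = (-1::real)" and \<delta>: "0 < \<delta>"
    and \<rho>: "density_pos d (\<rho> \<theta>)" "density_pos d (\<rho> (\<theta> + e * \<delta>))" and M: "povm (d ^ n) M"
    and bias: "bias_defined \<rho> g n M \<theta>" "bias_defined \<rho> g n M (\<theta> + e * \<delta>)"
    and V: "mse \<rho> g n M \<theta> = ereal V"
  shows "(bias \<rho> g n M (\<theta> + e * \<delta>) + e * \<delta> * Dq t \<delta> g \<theta> - bias \<rho> g n M \<theta>)\<^sup>2
    \<le> \<delta>\<^sup>2 * Re (mtrace (tpow (\<rho> \<theta>) n * LR d \<rho> n t \<theta> \<delta> * adj (LR d \<rho> n t \<theta> \<delta>))) * V"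
proof -
  let ?\<sigma> = "tpow (\<rho> \<theta>) n" and ?\<tau> = "tpow (\<rho> (\<theta> + e * \<delta>)) n" and ?N = "d ^ n"
  let ?L = "LR d \<rho> n t \<theta> \<delta>"
  \<comment> \<open>For \<open>t = 0\<close> the difference quotient is base state minus displaced
    state. The sign in \<open>s\<close> makes both cases yield displaced minus base.\<close>
  define s where "s = complex_of_real (e * \<delta>)"
  note \<sigma> = density_pos_tpow[OF \<rho>(1), of n] and \<tau> = density_pos_tpow[OF \<rho>(2), of n]
  have c: "?\<sigma> \<in> carrier_mat ?N ?N" "?\<tau> \<in> carrier_mat ?N ?N"
    using pos_semidefD(1)[OF \<sigma>(1)] pos_semidefD(1)[OF \<tau>(1)] by auto
  have "Dq_tpow t \<delta> \<rho> n \<theta> \<in> carrier_mat ?N ?N"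
    unfolding Dq_tpow_def using te c by auto
  note L = LR_solves[OF \<rho>(1) this]
  have D: "s \<cdot>\<^sub>m Dq_tpow t \<delta> \<rho> n \<theta> = ?\<tau> - ?\<sigma>"
    by (rule eq_matI) (use te c \<delta> in \<open>auto simp: Dq_tpow_def s_def\<close>)
  have K: "s \<cdot>\<^sub>m ?L \<in> carrier_mat ?N ?N" "?\<sigma> * (s \<cdot>\<^sub>m ?L) = ?\<tau> - ?\<sigma>"
    using L c D by (auto simp: mult_smult_distrib[of _ ?N ?N])
  have "?\<sigma> * (s \<cdot>\<^sub>m ?L) * adj (s \<cdot>\<^sub>m ?L) = (s * cnj s) \<cdot>\<^sub>m (?\<sigma> * ?L * adj ?L)"
    using L(1) c(1)
    by (simp add: adj_smult mult_smult_distrib[of _ ?N ?N _ ?N] mult_smult_assoc_mat[of _ ?N ?N _ ?N]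
        mult.commute)
  \<comment> \<open>The sign of \<open>e\<close> disappears here, so both cases get the same
    factor.\<close>
  moreover have "s * cnj s = complex_of_real (\<delta>\<^sup>2)"
    using te by (auto simp: s_def power2_eq_square)
  ultimately have tr: "Re (mtrace (?\<sigma> * (s \<cdot>\<^sub>m ?L) * adj (s \<cdot>\<^sub>m ?L))) = \<delta>\<^sup>2 * Re (mtrace (?\<sigma> * ?L * adj ?L))"
    using L(1) c by (simp add: mtrace_smult[of _ ?N] del: of_real_power)
  \<comment> \<open>A real value of the extended mean squared error means a finite second moment, as
    \<open>bias_diff_le\<close> requires.\<close>
  have nn: "(\<integral>\<^sup>+\<gamma>. ennreal ((\<gamma> - g \<theta>)\<^sup>2) \<partial>(outcome_dist ?\<sigma> M)) = ennreal V" "0 \<le> V"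
  proof -
    have "0 \<le> mse \<rho> g n M \<theta>" by (simp add: mse_def)
    then show "0 \<le> V" using V by simp
    then have "enn2ereal (\<integral>\<^sup>+\<gamma>. ennreal ((\<gamma> - g \<theta>)\<^sup>2) \<partial>(outcome_dist ?\<sigma> M)) = enn2ereal (ennreal V)"
      using V by (simp add: mse_def enn2ereal_ennreal)
    then show "(\<integral>\<^sup>+\<gamma>. ennreal ((\<gamma> - g \<theta>)\<^sup>2) \<partial>(outcome_dist ?\<sigma> M)) = ennreal V"
      by (simp only: enn2ereal_inject)
  qed
  have g: "e * \<delta> * Dq t \<delta> g \<theta> = g (\<theta> + e * \<delta>) - g \<theta>"
    using te \<delta> by (auto simp: Dq_def)
  show ?thesis
    using bias_diff_le[OF \<sigma>(1,2) \<tau>(1,2) K M _ _ nn] bias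
    unfolding g tr bias_def bias_defined_def by blast
qed

section \<open>The asymptotic bound\<close>

text \<open>If the liminf of \<open>y\<close> were too small, there would be \<open>w\<close> above
  it and \<open>j'\<close> above \<open>J\<close> with j' w < D^2, and one fixed small
  \<open>h\<close> with the limsup of \<open>x h\<close> below \<open>j'\<close>. Eventually the
  square of \<open>a h n\<close> then exceeds h^2 j' w, whereas \<open>y n < w\<close> would force
  the opposite. Infinite values of \<open>y n\<close> lie above \<open>w\<close> anyway, so
  \<open>bound\<close> speaks of real values.\<close>

lemma liminf_ge_of_square_bound:
  fixes x a :: "real \<Rightarrow> nat \<Rightarrow> real" and y :: "nat \<Rightarrow> ereal" and D :: real
  assumes h0: "0 < h0"
    and a: "\<And>h. 0 < h \<Longrightarrow> h < h0 \<Longrightarrow> ((\<lambda>n. (a h n)\<^sup>2) \<longlonglongrightarrow> h\<^sup>2 * D\<^sup>2)"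
    and bound: "\<And>h. 0 < h \<Longrightarrow> h < h0 \<Longrightarrow>
      (\<forall>\<^sub>F n in sequentially. \<forall>v. y n = ereal v \<longrightarrow> (a h n)\<^sup>2 \<le> h\<^sup>2 * x h n * v)"
    and y: "\<And>n. 0 \<le> y n"
    and J: "J = Limsup (at_right 0) (\<lambda>h. limsup (\<lambda>n. ereal (x h n)))" "0 < J" "J < \<infinity>"
  shows "ereal (D\<^sup>2 / real_of_ereal J) \<le> liminf y"
proof (rule ccontr)
  obtain j where j: "J = ereal j" "0 < j" using J(2,3) by (cases J) auto
  assume "\<not> ereal (D\<^sup>2 / real_of_ereal J) \<le> liminf y"
  then have "liminf y < ereal (D\<^sup>2 / j)" by (simp add: j)
  then obtain w where w: "liminf y < ereal w" "w < D\<^sup>2 / j"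
    using ereal_dense2 by (metis less_ereal.simps(1))
  \<comment> \<open>Nonnegativity of \<open>y\<close> makes \<open>w\<close> positive, which permits
    the division by \<open>w\<close> in choosing \<open>j'\<close>.\<close>
  have "0 \<le> liminf y" using y by (intro Liminf_bounded) auto
  then have "0 < ereal w" using w(1) by (rule le_less_trans)
  then have "0 < w" by simp
  then have "j < D\<^sup>2 / w" using w(2) j(2) by (simp add: field_simps)
  then obtain j' where j': "j < j'" "j' < D\<^sup>2 / w" using dense by blast
  have "0 < j'" using j j' by simp
  have "J < ereal j'" using j j' by simp
  then have "\<forall>\<^sub>F h in at_right 0. limsup (\<lambda>n. ereal (x h n)) < ereal j'"
    unfolding J(1) by (rule Limsup_lessD)
  moreover have "\<forall>\<^sub>F h in at_right 0. h < h0 \<and> 0 < h"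
    using h0 by (auto simp: eventually_at_right_field)
  ultimately have "\<forall>\<^sub>F h in at_right 0. limsup (\<lambda>n. ereal (x h n)) < ereal j' \<and> h < h0 \<and> 0 < h"
    by (rule eventually_conj)
  then obtain h where h: "limsup (\<lambda>n. ereal (x h n)) < ereal j'" "h < h0" "0 < h"
    using eventually_happens trivial_limit_at_right_real by blast
  have x: "\<forall>\<^sub>F n in sequentially. x h n < j'"
    using Limsup_lessD[OF h(1)] by simp
  have "j' * w < D\<^sup>2" using j' \<open>0 < w\<close> by (simp add: field_simps)
  then have "h\<^sup>2 * (j' * w) < h\<^sup>2 * D\<^sup>2" using h(3) by simp
  then have "\<forall>\<^sub>F n in sequentially. h\<^sup>2 * (j' * w) < (a h n)\<^sup>2"
    by (rule order_tendstoD(1)[OF a[OF h(3,2)]])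
  from this x bound[OF h(3,2)] have "\<forall>\<^sub>F n in sequentially. ereal w \<le> y n"
  proof eventually_elim
    case (elim n)
    show ?case
    proof (rule ccontr)
      assume "\<not> ereal w \<le> y n"
      then obtain v where v: "y n = ereal v" "0 \<le> v" "v < w"
        using y[of n] by (cases "y n") auto
      have "(a h n)\<^sup>2 \<le> h\<^sup>2 * (x h n * v)" using elim(3) v(1) by (simp add: mult.assoc)
      also have "\<dots> \<le> h\<^sup>2 * (j' * w)"
        using elim(2) v \<open>0 < w\<close> \<open>0 < j'\<close>
        by (intro mult_left_mono) (auto intro: order_trans[OF mult_right_mono mult_left_mono])
      finally show False using elim(1) by simp
    qed
  qed
  then have "ereal w \<le> liminf y" by (rule Liminf_bounded)
  then show False using w(1) by simp
qed

text \<open>Applies \<open>finite_difference_bound\<close> with step \<open>h / c n\<close> and lets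
  \<open>n\<close> grow for fixed \<open>h\<close>. The sign \<open>e\<close> treats both directions
  at once.\<close>

lemma one_sided_bound:
  fixes c :: "nat \<Rightarrow> real" and e t :: real
  assumes te: "t = 1 \<and> e = 1 \<or> t = 0 \<and> e = -1"
    and model: "qmodel d \<Theta> \<rho>" and interior: "\<theta> \<in> interior \<Theta>"
    and c_pos: "\<forall>n. 0 < c n" and c_lim: "filterlim c at_top sequentially"
    and M_povm: "\<forall>n. povm (d ^ n) (M n)"
    and unb: "\<exists>h0>0. \<forall>h. 0 \<le> h \<and> h < h0 \<longrightarrow>
     (\<forall>\<^sub>F n in sequentially. bias_defined \<rho> g n (M n) (\<theta> + e * (h / c n))) \<and>
     ((\<lambda>n. c n * bias \<rho> g n (M n) (\<theta> + e * (h / c n))) \<longlonglongrightarrow> 0)"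
    and deriv: "((\<lambda>\<delta>. Dq t \<delta> g \<theta>) \<longlongrightarrow> D) (at_right 0)"
    and J: "0 < JR d \<rho> c t \<theta>" "JR d \<rho> c t \<theta> < \<infinity>"
  shows "liminf (\<lambda>n. ereal ((c n)\<^sup>2) * mse \<rho> g n (M n) \<theta>)
             \<ge> ereal (D\<^sup>2 / real_of_ereal (JR d \<rho> c t \<theta>))"
proof -
  obtain h0 where h0: "0 < h0" and
    defd: "\<And>h. 0 \<le> h \<Longrightarrow> h < h0 \<Longrightarrow>
      \<forall>\<^sub>F n in sequentially. bias_defined \<rho> g n (M n) (\<theta> + e * (h / c n))" and
    lim: "\<And>h. 0 \<le> h \<Longrightarrow> h < h0 \<Longrightarrow>
      (\<lambda>n. c n * bias \<rho> g n (M n) (\<theta> + e * (h / c n))) \<longlonglongrightarrow> 0"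
    using unb by blast
  \<comment> \<open>The case \<open>h = 0\<close> of unbiasedness controls the bias at \<theta>
    itself, which is subtracted in \<open>a\<close>.\<close>
  have defd0: "\<forall>\<^sub>F n in sequentially. bias_defined \<rho> g n (M n) \<theta>"
    and lim0: "(\<lambda>n. c n * bias \<rho> g n (M n) \<theta>) \<longlonglongrightarrow> 0"
    using defd[of 0] lim[of 0] h0 by simp_all
  \<comment> \<open>This is \<open>c n\<close> times the bracket in
    \<open>finite_difference_bound\<close> for the step \<open>h / c n\<close>; the factor
    \<open>c n\<close> cancels the denominator and leaves \<open>e * h\<close> before the quotient
    of \<open>g\<close>.\<close>
  define a where "a = (\<lambda>h n. c n * bias \<rho> g n (M n) (\<theta> + e * (h / c n))
    + e * h * Dq t (h / c n) g \<theta> - c n * bias \<rho> g n (M n) \<theta>)"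
  define I where "I = (\<lambda>h n. Re (mtrace (tpow (\<rho> \<theta>) n * LR d \<rho> n t \<theta> (h / c n) * adj (LR d \<rho> n t \<theta> (h / c n)))))"
  have hc: "(\<lambda>n. h / c n) \<longlonglongrightarrow> 0" for h :: real
    by (rule real_tendsto_divide_at_top[OF tendsto_const c_lim])
  have dens: "density_pos d (\<rho> \<theta>')" if "\<theta>' \<in> \<Theta>" for \<theta>'
    using model that by (simp add: qmodel_def)
  show ?thesis
  proof (rule liminf_ge_of_square_bound[OF h0, where a = a and x = "\<lambda>h n. I h n / (c n)\<^sup>2"])
    fix h :: real assume h: "0 < h" "h < h0"
    \<comment> \<open>The steps tend to 0 through positive values, as the one-sided limit
      \<open>deriv\<close> requires.\<close>
    have "filterlim (\<lambda>n. h / c n) (at_right 0) sequentially"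
      using hc h c_pos by (auto simp: filterlim_at less_imp_neq[symmetric])
    then have "(\<lambda>n. Dq t (h / c n) g \<theta>) \<longlonglongrightarrow> D"
      by (rule filterlim_compose[OF deriv])
    then have "a h \<longlonglongrightarrow> 0 + e * h * D - 0"
      unfolding a_def using h by (intro tendsto_intros lim lim0) auto
    then have "(\<lambda>n. (a h n)\<^sup>2) \<longlonglongrightarrow> (0 + e * h * D - 0)\<^sup>2"
      by (rule tendsto_power)
    also have "(0 + e * h * D - 0)\<^sup>2 = h\<^sup>2 * D\<^sup>2"
      using te by (auto simp: power_mult_distrib)
    finally show "(\<lambda>n. (a h n)\<^sup>2) \<longlonglongrightarrow> h\<^sup>2 * D\<^sup>2" .
    have "(\<lambda>n. \<theta> + e * (h / c n)) \<longlonglongrightarrow> \<theta> + e * 0"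
      by (intro tendsto_intros hc)
    \<comment> \<open>The displaced parameters eventually stay in \<Theta>, where \<rho> takes
      density matrices as values.\<close>
    then have "\<forall>\<^sub>F n in sequentially. \<theta> + e * (h / c n) \<in> interior \<Theta>"
      using interior by (auto intro: topological_tendstoD)
    moreover have "\<forall>\<^sub>F n in sequentially. bias_defined \<rho> g n (M n) (\<theta> + e * (h / c n))"
      using defd h by simp
    ultimately show "\<forall>\<^sub>F n in sequentially. \<forall>v. ereal ((c n)\<^sup>2) * mse \<rho> g n (M n) \<theta> = ereal v
      \<longrightarrow> (a h n)\<^sup>2 \<le> h\<^sup>2 * (I h n / (c n)\<^sup>2) * v"
      using defd0
    proof eventually_elim
      case (elim n)
      have c: "0 < c n" using c_pos by simp
      show ?case
      proof (intro allI impI)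
        fix v assume v: "ereal ((c n)\<^sup>2) * mse \<rho> g n (M n) \<theta> = ereal v"
        \<comment> \<open>Since \<open>c n\<close> is positive, a finite scaled error forces a
          finite error.\<close>
        then obtain V where V: "mse \<rho> g n (M n) \<theta> = ereal V"
          using c by (cases "mse \<rho> g n (M n) \<theta>") auto
        have v': "v = (c n)\<^sup>2 * V" using v V by simp
        have \<rho>: "density_pos d (\<rho> \<theta>)" "density_pos d (\<rho> (\<theta> + e * (h / c n)))"
          using dens interior elim(1) interior_subset by blast+
        have "a h n = c n * (bias \<rho> g n (M n) (\<theta> + e * (h / c n))
            + e * (h / c n) * Dq t (h / c n) g \<theta> - bias \<rho> g n (M n) \<theta>)"
          using c by (simp add: a_def algebra_simps)
        then have "(a h n)\<^sup>2 = (c n)\<^sup>2 * (bias \<rho> g n (M n) (\<theta> + e * (h / c n))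
            + e * (h / c n) * Dq t (h / c n) g \<theta> - bias \<rho> g n (M n) \<theta>)\<^sup>2"
          by (simp add: power_mult_distrib)
        also have "\<dots> \<le> (c n)\<^sup>2 * ((h / c n)\<^sup>2 * I h n * V)"
          unfolding I_def using te \<rho> M_povm elim V h c
          by (intro mult_left_mono finite_difference_bound) auto
        also have "\<dots> = h\<^sup>2 * (I h n / (c n)\<^sup>2) * v"
          using c by (simp add: v' power_divide field_simps)
        finally show "(a h n)\<^sup>2 \<le> h\<^sup>2 * (I h n / (c n)\<^sup>2) * v" .
      qed
    qed
  next
    show "0 \<le> ereal ((c n)\<^sup>2) * mse \<rho> g n (M n) \<theta>" for n
      by (simp add: mse_def)
  qed (use J in \<open>auto simp: JR_def I_def\<close>)
qed

theorem theorem4: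
  fixes d :: nat and \<Theta> :: "real set" and \<rho> :: "real \<Rightarrow> complex mat"
    and g :: "real \<Rightarrow> real" and \<theta> :: real and c :: "nat \<Rightarrow> real"
    and M :: "nat \<Rightarrow> real set \<Rightarrow> complex mat"
  assumes model: "qmodel d \<Theta> \<rho>"
    and interior: "\<theta> \<in> interior \<Theta>"
    and c_pos: "\<forall>n. 0 < c n" and c_inc: "incseq c" and c_lim: "filterlim c at_top sequentially"
    and M_povm: "\<forall>n. povm (d ^ n) (M n)"
  shows
   "(\<forall>D::real. cn_unbiased_right \<rho> g c M \<theta>
       \<and> ((\<lambda>\<delta>. Dq 1 \<delta> g \<theta>) \<longlongrightarrow> D) (at_right 0)
       \<and> 0 < JR d \<rho> c 1 \<theta> \<and> JR d \<rho> c 1 \<theta> < \<infinity>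
       \<longrightarrow> liminf (\<lambda>n. ereal ((c n)\<^sup>2) * mse \<rho> g n (M n) \<theta>)
             \<ge> ereal (D\<^sup>2 / real_of_ereal (JR d \<rho> c 1 \<theta>)))
  \<and> (\<forall>D::real. cn_unbiased_left \<rho> g c M \<theta>
       \<and> ((\<lambda>\<delta>. Dq 0 \<delta> g \<theta>) \<longlongrightarrow> D) (at_right 0)
       \<and> 0 < JR d \<rho> c 0 \<theta> \<and> JR d \<rho> c 0 \<theta> < \<infinity>
       \<longrightarrow> liminf (\<lambda>n. ereal ((c n)\<^sup>2) * mse \<rho> g n (M n) \<theta>)
             \<ge> ereal (D\<^sup>2 / real_of_ereal (JR d \<rho> c 0 \<theta>)))"
proof (intro conjI allI impI; elim conjE)
  fix D :: real
  assume "cn_unbiased_right \<rho> g c M \<theta>"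
    and *: "((\<lambda>\<delta>. Dq 1 \<delta> g \<theta>) \<longlongrightarrow> D) (at_right 0)" "0 < JR d \<rho> c 1 \<theta>" "JR d \<rho> c 1 \<theta> < \<infinity>"
  then have "\<exists>h0>0. \<forall>h. 0 \<le> h \<and> h < h0 \<longrightarrow>
     (\<forall>\<^sub>F n in sequentially. bias_defined \<rho> g n (M n) (\<theta> + 1 * (h / c n))) \<and>
     ((\<lambda>n. c n * bias \<rho> g n (M n) (\<theta> + 1 * (h / c n))) \<longlonglongrightarrow> 0)"
    by (simp add: cn_unbiased_right_def)
  from one_sided_bound[OF _ model interior c_pos c_lim M_povm this *]
  show "liminf (\<lambda>n. ereal ((c n)\<^sup>2) * mse \<rho> g n (M n) \<theta>)
      \<ge> ereal (D\<^sup>2 / real_of_ereal (JR d \<rho> c 1 \<theta>))" by simp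
next
  fix D :: real
  assume "cn_unbiased_left \<rho> g c M \<theta>"
    and *: "((\<lambda>\<delta>. Dq 0 \<delta> g \<theta>) \<longlongrightarrow> D) (at_right 0)" "0 < JR d \<rho> c 0 \<theta>" "JR d \<rho> c 0 \<theta> < \<infinity>"
  \<comment> \<open>The left shift is written with \<open>e = -1\<close>, paired with
    \<open>t = 0\<close>.\<close>
  then have "\<exists>h0>0. \<forall>h. 0 \<le> h \<and> h < h0 \<longrightarrow>
     (\<forall>\<^sub>F n in sequentially. bias_defined \<rho> g n (M n) (\<theta> + (-1) * (h / c n))) \<and>
     ((\<lambda>n. c n * bias \<rho> g n (M n) (\<theta> + (-1) * (h / c n))) \<longlonglongrightarrow> 0)"
    by (simp add: cn_unbiased_left_def)
  from one_sided_bound[OF _ model interior c_pos c_lim M_povm this *]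
  show "liminf (\<lambda>n. ereal ((c n)\<^sup>2) * mse \<rho> g n (M n) \<theta>)
      \<ge> ereal (D\<^sup>2 / real_of_ereal (JR d \<rho> c 0 \<theta>))" by simp
qed

end
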